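(* Let $q>1$ and let $E\subset[0,1]$ be a measurable set with $m(E)>0$. There exist constants $A'(M_2,q),B'(M_2,q)>0$ and an integer $N=N(E)$ such that, for every $q$-lacunary sequence $(w_{n_k})_{k\ge1}$ of Walsh functions with $n_k\ge N$ for all $k\ge1$, we have $$A'(M_2,q)\Big(\sum_{k=1}^\infty a_k^2\Big)^{1/2}\le \Big\|\sum_{k\ge1}a_kw_{n_k}\Big\|_{L^{M_2}|E}\le B'(M_2,q)\Big(\sum_{k=1}^\infty a_k^2\Big)^{1/2}$$ for all $(a_k)_{k\ge1}\in\ell^2$.
   Context: $m$ is Lebesgue measure on $[0,1]$. Rademacher functions: $r_k(t)=\mathrm{sign}\sin(2^k\pi t)$, $t\in[0,1]$, $k\ge1$. Walsh system (Paley numbering): $w_0=1$ and for $k=a_12^0+a_22^1+\dots+a_n2^{n-1}$ with $a_i\in\{0,1\}$, $w_k=r_1^{a_1}\cdots r_n^{a_n}$. A sequence $(w_{n_k})$ is $q$-lacunary if $n_{k+1}/n_k\ge q>1$ for all $k\ge1$. For $M_2(t)=\exp(t^2)-1$ and a measurable $E$ with $m(E)>0$, the local Orlicz norm is $\|f\|_{L^{M_2}|E}=\inf\{\lambda>0:\int_E M_2(|f|/\lambda)\,\frac{dm}{m(E)}\le1\}$ for measurable $f$ on $E$. The series $\sum a_kw_{n_k}$ for $(a_k)\in\ell^2$ is understood as its $L^2$-sum. *)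

theory Defs
  imports "HOL-Analysis.Analysis"
begin

definition rademacher :: "nat \<Rightarrow> real \<Rightarrow> real" where
  "rademacher k t = sgn (sin (2 ^ k * pi * t))"

text \<open>Walsh functions in Paley numbering: bit i of n (i.e. a_{i+1}) selects r_{i+1}.\<close>
definition walsh :: "nat \<Rightarrow> real \<Rightarrow> real" where
  "walsh n t = (\<Prod>i<n. if bit n i then rademacher (Suc i) t else 1)"

definition M2 :: "real \<Rightarrow> real" where
  "M2 s = exp (s\<^sup>2) - 1"

text \<open>Local Orlicz norm on E (value \<infinity> if no admissible lambda exists).\<close>
definition local_orlicz_norm :: "(real \<Rightarrow> real) \<Rightarrow> real set \<Rightarrow> ereal" where
  "local_orlicz_norm f E =
     Inf (ereal ` {c::real. c > 0 \<and>
        (\<integral>\<^sup>+ t\<in>E. ennreal (M2 (\<bar>f t\<bar> / c)) \<partial>lebesgue) \<le> ennreal (measure lebesgue E)})"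

definition lacunary :: "real \<Rightarrow> (nat \<Rightarrow> nat) \<Rightarrow> bool" where
  "lacunary q n \<longleftrightarrow> (\<forall>k. real (n (Suc k)) / real (n k) \<ge> q)"

definition is_L2_sum :: "(nat \<Rightarrow> real) \<Rightarrow> (nat \<Rightarrow> nat) \<Rightarrow> (real \<Rightarrow> real) \<Rightarrow> bool" where
  "is_L2_sum a n f \<longleftrightarrow> f \<in> borel_measurable (lebesgue_on {0..1}) \<and>
     ((\<lambda>K. \<integral>\<^sup>+ t\<in>{0..1}. ennreal ((f t - (\<Sum>k<K. a k * walsh (n k) t))\<^sup>2) \<partial>lebesgue)
        \<longlonglongrightarrow> 0)"

end

theory Submission
  imports Defs
begin

text \<open>
  If \<open>w\<close> has leading bit \<open>j\<close> and \<open>S\<close> is constant on dyadic intervals of rank \<open>j\<close>, then averaging over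
  the sign of \<open>w\<close> and \<open>cosh x \<le> exp (x\<^sup>2 / 2)\<close> bound \<open>\<integral> exp (s (S + a w)\<^sup>2)\<close> by
  \<open>exp (s a\<^sup>2) \<integral> exp (s (1 + 2 s a\<^sup>2) S\<^sup>2)\<close>. Iterating this gives exponential square integrability for
  Walsh sums whose indices at least double, on every union of dyadic intervals that is coarse compared
  with the first index. A \<open>q\<close>-lacunary sequence splits into \<open>L\<close> such sequences when \<open>q ^ L \<ge> 2\<close>.
  A general set \<open>E\<close> differs from such a union \<open>F\<close> by a set so small, relative to \<open>m(E)\<close>, that its
  contribution is absorbed by the global exponential bound. For the lower estimate, \<open>M2 s \<ge> s\<^sup>2\<close> reduces
  matters to the \<open>L\<^sup>2\<close> norm over \<open>F\<close>, where high-frequency Walsh functions from different blocks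
  of length \<open>2 ^ j\<close> are orthogonal.
\<close>

unbundle bit_operations_syntax

section \<open>Dyadic cells and Walsh functions\<close>

text \<open>Measurability with respect to the half-open dyadic intervals of length
  \<open>1 / 2 ^ j\<close> on the whole line, the cells of rank \<open>j\<close>. The codomain is
  arbitrary, so that \<open>\<lambda>t. t \<in> F\<close> can express that \<open>F\<close> is a
  union of cells.\<close>

definition dyadic_measurable :: "nat \<Rightarrow> (real \<Rightarrow> 'a) \<Rightarrow> bool" where
  "dyadic_measurable j g \<longleftrightarrow> (\<forall>s t. \<lfloor>2 ^ j * s\<rfloor> = \<lfloor>2 ^ j * t\<rfloor> \<longrightarrow> g s = g t)"

text \<open>The right-continuous Rademacher functions take only the values \<open>1\<close> and \<open>-1\<close>, whereas
  \<^const>\<open>rademacher\<close> vanishes at dyadic rationals; the two agree almost everywhere.\<close>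

definition rademacher_rc :: "nat \<Rightarrow> real \<Rightarrow> real" where
  "rademacher_rc k t = (if even \<lfloor>2 ^ k * t\<rfloor> then 1 else - 1)"

definition walsh_rc :: "nat \<Rightarrow> real \<Rightarrow> real" where
  "walsh_rc n t = (\<Prod>i<n. if bit n i then rademacher_rc (Suc i) t else 1)"

lemma dyadic_measurableD:
  "dyadic_measurable j g \<Longrightarrow> \<lfloor>2 ^ j * s\<rfloor> = \<lfloor>2 ^ j * t\<rfloor> \<Longrightarrow> g s = g t"
  unfolding dyadic_measurable_def by blast

text \<open>The index of a coarse cell is an integer quotient of the index of any finer cell inside
  it.\<close>

lemma dyadic_measurable_mono:
  assumes "dyadic_measurable i g" "i \<le> j"
  shows "dyadic_measurable j g"
proof -
  have *: "\<lfloor>2 ^ i * s\<rfloor> = \<lfloor>2 ^ j * s\<rfloor> div 2 ^ (j - i)" for s :: real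
  proof -
    have "2 ^ i * s = 2 ^ j * s / real_of_int (2 ^ (j - i))"
      using assms(2) by (simp add: field_simps flip: power_add)
    then show ?thesis
      using floor_divide_real_eq_div[of "2 ^ (j - i)" "2 ^ j * s"] by simp
  qed
  show ?thesis
    using assms(1) unfolding dyadic_measurable_def * by metis
qed

lemma dyadic_measurable_const: "dyadic_measurable j (\<lambda>t. c)"
  by (simp add: dyadic_measurable_def)

lemma dyadic_measurable_compose:
  "dyadic_measurable j g \<Longrightarrow> dyadic_measurable j (\<lambda>t. G (g t))"
  unfolding dyadic_measurable_def by metis

lemma dyadic_measurable_compose2:
  "dyadic_measurable j g \<Longrightarrow> dyadic_measurable j h \<Longrightarrow> dyadic_measurable j (\<lambda>t. G (g t) (h t))"
  unfolding dyadic_measurable_def by metis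

lemma dyadic_measurable_sum:
  assumes "\<And>i. i \<in> I \<Longrightarrow> dyadic_measurable j (g i)"
  shows "dyadic_measurable j (\<lambda>t. \<Sum>i\<in>I. g i t :: real)"
  using assms unfolding dyadic_measurable_def by (intro allI impI sum.cong refl) blast

lemma dyadic_measurable_prod:
  assumes "\<And>i. i \<in> I \<Longrightarrow> dyadic_measurable j (g i)"
  shows "dyadic_measurable j (\<lambda>t. \<Prod>i\<in>I. g i t :: real)"
  using assms unfolding dyadic_measurable_def by (intro allI impI prod.cong refl) blast

text \<open>\<open>g\<close> factors through the integer cell index, a measurable map into a
  countable discrete space on which every function is measurable.\<close>

lemma borel_measurable_dyadic_measurable:
  fixes g :: "real \<Rightarrow> 'a::topological_space"
  assumes "dyadic_measurable j g"
  shows "g \<in> borel_measurable borel"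
proof -
  have *: "g t = g (real_of_int \<lfloor>2 ^ j * t\<rfloor> / 2 ^ j)" for t
    by (rule dyadic_measurableD[OF assms]) simp
  define G where "G = (\<lambda>m::int. g (real_of_int m / 2 ^ j))"
  have "(\<lambda>t::real. \<lfloor>2 ^ j * t\<rfloor>) \<in> measurable borel (count_space UNIV)"
    by measurable
  then have "(\<lambda>t::real. G \<lfloor>2 ^ j * t\<rfloor>) \<in> borel_measurable borel"
    by (rule measurable_compose) simp
  also have "(\<lambda>t::real. G \<lfloor>2 ^ j * t\<rfloor>) = g"
    unfolding G_def using * by (intro ext) (rule sym)
  finally show ?thesis .
qed

lemma dyadic_measurable_rademacher_rc: "dyadic_measurable k (rademacher_rc k)"
  by (simp add: dyadic_measurable_def rademacher_rc_def)

lemma bit_nat_imp_power_le: "bit (n::nat) i \<Longrightarrow> 2 ^ i \<le> n"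
  by (metis bit_iff_odd div_less even_zero not_less)

text \<open>The bits of \<open>n\<close> from position \<open>j\<close> on vanish. The freedom in
  \<open>j\<close> gives two Walsh functions a common range of factors and exposes the leading
  bit.\<close>

lemma walsh_rc_eq_prod:
  assumes "n < 2 ^ j"
  shows "walsh_rc n t = (\<Prod>i<j. if bit n i then rademacher_rc (Suc i) t else 1)"
proof -
  have *: "\<not> bit n i" if "j \<le> i \<or> n \<le> i" for i
  proof
    assume "bit n i"
    then have "2 ^ i \<le> n" by (rule bit_nat_imp_power_le)
    have "i < n" using less_exp[of i] \<open>2 ^ i \<le> n\<close> by linarith
    have "(2::nat) ^ i < 2 ^ j" using assms \<open>2 ^ i \<le> n\<close> by linarith
    then have "i < j" by simp
    with \<open>i < n\<close> that show False by simp
  qed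
  show ?thesis
    unfolding walsh_rc_def by (rule prod.mono_neutral_cong) (simp_all add: *)
qed

lemma dyadic_measurable_walsh_rc:
  assumes "n < 2 ^ j"
  shows "dyadic_measurable j (walsh_rc n)"
proof -
  have "dyadic_measurable j (\<lambda>t. if bit n i then rademacher_rc (Suc i) t else 1)" if "i < j" for i
    using dyadic_measurable_mono[OF dyadic_measurable_rademacher_rc, of "Suc i" j] that
    by (cases "bit n i") (auto simp: dyadic_measurable_const)
  then have "dyadic_measurable j (\<lambda>t. \<Prod>i<j. if bit n i then rademacher_rc (Suc i) t else 1)"
    by (intro dyadic_measurable_prod) auto
  moreover have "walsh_rc n = (\<lambda>t. \<Prod>i<j. if bit n i then rademacher_rc (Suc i) t else 1)"
    by (rule ext) (rule walsh_rc_eq_prod[OF assms])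
  ultimately show ?thesis
    by simp
qed

lemma borel_measurable_walsh_rc [measurable]: "walsh_rc n \<in> borel_measurable borel"
  by (rule borel_measurable_dyadic_measurable[OF dyadic_measurable_walsh_rc[OF less_exp]])

lemma walsh_rc_values: "walsh_rc n t \<in> {1, - 1}"
proof -
  have "(\<Prod>i\<in>I. if bit n i then rademacher_rc (Suc i) t else 1) \<in> {1, - 1}" if "finite I" for I
    using that by induction (auto simp: rademacher_rc_def)
  then show ?thesis
    unfolding walsh_rc_def by blast
qed

text \<open>Squares of \<open>rademacher_rc\<close> equal 1, so common factors cancel and the bits
  add modulo 2. The identity holds at every point, which fails for \<open>walsh\<close> at points
  such as 0.\<close>

lemma walsh_rc_mult: "walsh_rc n t * walsh_rc m t = walsh_rc (n XOR m) t"
proof -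
  define j where "j = max n m"
  have "n < 2 ^ j"
    by (rule le_less_trans[OF _ less_exp]) (simp add: j_def)
  have "m < 2 ^ j"
    by (rule le_less_trans[OF _ less_exp]) (simp add: j_def)
  have "take_bit j (n XOR m) = n XOR m"
    using \<open>n < 2 ^ j\<close> \<open>m < 2 ^ j\<close> by (simp add: take_bit_nat_eq_self)
  then have "n XOR m < 2 ^ j"
    using take_bit_nat_less_exp[of j "n XOR m"] by simp
  have "(if bit n i then rademacher_rc (Suc i) t else 1) * (if bit m i then rademacher_rc (Suc i) t else 1)
      = (if bit (n XOR m) i then rademacher_rc (Suc i) t else 1)" for i
    by (auto simp: bit_xor_iff rademacher_rc_def)
  then show ?thesis
    unfolding walsh_rc_eq_prod[OF \<open>n < 2 ^ j\<close>] walsh_rc_eq_prod[OF \<open>m < 2 ^ j\<close>]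
      walsh_rc_eq_prod[OF \<open>n XOR m < 2 ^ j\<close>] prod.distrib[symmetric]
    by (intro prod.cong refl)
qed

text \<open>Splits off the Rademacher factor of the leading bit; all other factors have rank at most
  \<open>j\<close>.\<close>

lemma walsh_rc_split_top:
  assumes "2 ^ j \<le> n" "n < 2 ^ Suc j"
  obtains v where "dyadic_measurable j v" "\<And>t. walsh_rc n t = v t * rademacher_rc (Suc j) t"
proof
  let ?v = "\<lambda>t. \<Prod>i<j. if bit n i then rademacher_rc (Suc i) t else 1"
  have "dyadic_measurable j (\<lambda>t. if bit n i then rademacher_rc (Suc i) t else 1)" if "i < j" for i
    using dyadic_measurable_mono[OF dyadic_measurable_rademacher_rc, of "Suc i" j] that
    by (cases "bit n i") (auto simp: dyadic_measurable_const)
  then show "dyadic_measurable j ?v"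
    by (intro dyadic_measurable_prod) (simp only: lessThan_iff)
  have "n div 2 ^ j = 1"
    using assms by (intro div_nat_eqI) (simp_all add: mult_2)
  then have "bit n j"
    by (simp add: bit_iff_odd)
  then show "walsh_rc n t = ?v t * rademacher_rc (Suc j) t" for t
    unfolding walsh_rc_eq_prod[OF assms(2)] by simp
qed

text \<open>The two systems can differ only where some \<open>2 ^ k * t\<close> is an integer, and
  such points are countable.\<close>

lemma AE_walsh_eq_walsh_rc: "AE t in lebesgue. \<forall>n. walsh n t = walsh_rc n t"
proof -
  define D :: "real set" where "D = (\<Union>k. range (\<lambda>m. real_of_int m / 2 ^ k))"
  have "countable D"
    unfolding D_def by auto
  then have "D \<in> null_sets lborel"
    by (rule countable_imp_null_set_lborel)
  then have "AE t in lborel. t \<notin> D"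
    by (rule AE_not_in)
  then have D: "AE t in lebesgue. t \<notin> D"
    by (rule AE_completion)
  have "rademacher k t = rademacher_rc k t" if "t \<notin> D" for k t
  proof -
    define u where "u = 2 ^ k * t"
    define m where "m = \<lfloor>u\<rfloor>"
    have "u \<noteq> of_int m"
    proof
      assume "u = of_int m"
      then have "t = of_int m / 2 ^ k" by (simp add: u_def field_simps)
      then show False using that by (auto simp: D_def)
    qed
    then have frac: "0 < u - m" "u - m < 1"
      unfolding m_def by linarith+
    then have "sin (pi * (u - m)) > 0"
      by (intro sin_gt_zero) auto
    \<comment> \<open>\<open>cos (pi * m)\<close> is 1 or -1 according to the parity of
      \<open>m\<close>, so the sign of the sine is the parity of the floor.\<close>
    moreover have "sin (2 ^ k * pi * t) = cos (pi * m) * sin (pi * (u - m))"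
    proof -
      have "2 ^ k * pi * t = pi * m + pi * (u - m)" by (simp add: u_def algebra_simps)
      then show ?thesis by (simp add: sin_add del: sin_npi_int cos_npi_int) (simp add: sin_npi_int)
    qed
    ultimately show ?thesis
      by (simp add: rademacher_def rademacher_rc_def sgn_mult m_def u_def)
  qed
  then have "walsh n t = walsh_rc n t" if "t \<notin> D" for n t
    using that by (simp only: walsh_def walsh_rc_def not_False_eq_True)
  then show ?thesis by (intro eventually_mono[OF D] allI)
qed

text \<open>Each even cell of rank \<open>Suc j\<close> is paired with its right neighbour;
  translating the odd cells by one cell length folds the integral onto the even ones.\<close>

lemma nn_integral_dyadic_measurable:
  fixes g :: "real \<Rightarrow> ennreal"
  assumes "dyadic_measurable (Suc j) g"
  shows "(\<integral>\<^sup>+t. g t \<partial>lborel) =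
    (\<integral>\<^sup>+t. (g t + g (t + 1 / 2 ^ Suc j)) * indicator {t. even \<lfloor>2 ^ Suc j * t\<rfloor>} t \<partial>lborel)"
proof -
  let ?h = "1 / 2 ^ Suc j :: real"
  let ?A = "{t::real. even \<lfloor>2 ^ Suc j * t\<rfloor>}"
  have [measurable]: "g \<in> borel_measurable borel"
    using assms by (rule borel_measurable_dyadic_measurable)
  have "dyadic_measurable (Suc j) (\<lambda>t. t \<in> ?A)"
    by (simp add: dyadic_measurable_def)
  then have "dyadic_measurable (Suc j) (indicator ?A :: real \<Rightarrow> ennreal)"
    unfolding indicator_def by (rule dyadic_measurable_compose)
  then have [measurable]: "(indicator ?A :: real \<Rightarrow> ennreal) \<in> borel_measurable borel"
    by (rule borel_measurable_dyadic_measurable)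
  have shift: "indicator ?A (t + ?h) = (1 - indicator ?A t :: ennreal)" for t
  proof -
    have "\<lfloor>2 ^ Suc j * (t + ?h)\<rfloor> = \<lfloor>2 ^ Suc j * t + 1\<rfloor>"
      by (simp add: algebra_simps)
    also have "\<dots> = \<lfloor>2 ^ Suc j * t\<rfloor> + 1"
      by linarith
    finally show ?thesis by (auto simp: indicator_def)
  qed
  have "(\<integral>\<^sup>+t. g t \<partial>lborel) = (\<integral>\<^sup>+t. g t * indicator ?A t + g t * (1 - indicator ?A t) \<partial>lborel)"
    by (intro nn_integral_cong) (auto simp: indicator_def)
  also have "\<dots> = (\<integral>\<^sup>+t. g t * indicator ?A t \<partial>lborel) + (\<integral>\<^sup>+t. g t * (1 - indicator ?A t) \<partial>lborel)"
    by (intro nn_integral_add) measurable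
  also have "(\<integral>\<^sup>+t. g t * (1 - indicator ?A t) \<partial>lborel) =
      (\<integral>\<^sup>+t. g (?h + 1 * t) * (1 - indicator ?A (?h + 1 * t)) \<partial>lborel)"
    by (subst nn_integral_real_affine[where c = 1 and t = ?h]) auto
  also have "\<dots> = (\<integral>\<^sup>+t. g (t + ?h) * indicator ?A t \<partial>lborel)"
    by (intro nn_integral_cong) (simp only: mult_1 add.commute[of ?h] shift, simp add: indicator_def)
  finally show ?thesis
    by (subst (asm) nn_integral_add[symmetric]) (auto simp: distrib_right)
qed

text \<open>A Walsh function with leading bit \<open>j\<close> changes sign under translation by \<open>2 ^ (- (j + 1))\<close> inside
  each cell of rank \<open>j\<close>, so it behaves like a fair sign independent of that cell.\<close>

lemma nn_integral_walsh_rc_symmetric: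
  fixes \<phi> :: "real \<Rightarrow> real \<Rightarrow> ennreal"
  assumes n: "2 ^ j \<le> n" "n < 2 ^ Suc j"
    and \<phi>: "\<And>e. dyadic_measurable j (\<lambda>t. \<phi> t e)"
  shows "2 * (\<integral>\<^sup>+t. \<phi> t (walsh_rc n t) \<partial>lborel) = (\<integral>\<^sup>+t. \<phi> t 1 + \<phi> t (- 1) \<partial>lborel)"
proof -
  let ?h = "1 / 2 ^ Suc j :: real"
  let ?A = "{t::real. even \<lfloor>2 ^ Suc j * t\<rfloor>}"
  obtain v where v: "dyadic_measurable j v" "\<And>t. walsh_rc n t = v t * rademacher_rc (Suc j) t"
    using walsh_rc_split_top[OF n] by blast
  have floors: "\<lfloor>2 ^ Suc j * (t + ?h)\<rfloor> = \<lfloor>2 ^ Suc j * t\<rfloor> + 1" for t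
  proof -
    have "\<lfloor>2 ^ Suc j * (t + ?h)\<rfloor> = \<lfloor>2 ^ Suc j * t + 1\<rfloor>"
      by (simp add: algebra_simps)
    then show ?thesis by linarith
  qed
  \<comment> \<open>An even cell of rank \<open>Suc j\<close> is the left half of a cell of rank
    \<open>j\<close>, so the shift by \<open>?h\<close> stays inside the latter.\<close>
  have cell: "\<lfloor>2 ^ j * (t + ?h)\<rfloor> = \<lfloor>2 ^ j * t\<rfloor>" if "t \<in> ?A" for t
  proof -
    have *: "\<lfloor>2 ^ j * s\<rfloor> = \<lfloor>2 ^ Suc j * s\<rfloor> div 2" for s :: real
      using floor_divide_real_eq_div[of 2 "2 ^ Suc j * s"] by simp
    show ?thesis
      unfolding * floors using that by simp
  qed
  \<comment> \<open>The shift flips only the last Rademacher factor, so the two Walsh values are 1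
    and -1 in some order, and the sum does not see the order.\<close>
  have pair: "\<phi> t (walsh_rc n t) + \<phi> (t + ?h) (walsh_rc n (t + ?h)) = \<phi> t 1 + \<phi> t (- 1)"
    if "t \<in> ?A" for t
  proof -
    have "v (t + ?h) = v t" "\<phi> (t + ?h) e = \<phi> t e" for e
      using dyadic_measurableD[OF v(1) cell[OF that]] dyadic_measurableD[OF \<phi> cell[OF that]]
      by blast+
    moreover have "rademacher_rc (Suc j) t = 1" "rademacher_rc (Suc j) (t + ?h) = - 1"
      using that unfolding rademacher_rc_def floors by auto
    moreover have "v t \<in> {1, - 1}"
      using walsh_rc_values[of n t] v(2)[of t] calculation by auto
    ultimately show ?thesis
      unfolding v(2) by (auto simp: add.commute)
  qed
  have "dyadic_measurable (Suc j) (\<lambda>t. \<phi> t (walsh_rc n t))"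
    unfolding dyadic_measurable_def
  proof (intro allI impI)
    fix s t :: real
    assume st: "\<lfloor>2 ^ Suc j * s\<rfloor> = \<lfloor>2 ^ Suc j * t\<rfloor>"
    have "walsh_rc n s = walsh_rc n t"
      by (rule dyadic_measurableD[OF dyadic_measurable_walsh_rc[OF n(2)] st])
    then show "\<phi> s (walsh_rc n s) = \<phi> t (walsh_rc n t)"
      using dyadic_measurableD[OF dyadic_measurable_mono[OF \<phi> le_SucI[OF order_refl]] st] by simp
  qed
  then have "(\<integral>\<^sup>+t. \<phi> t (walsh_rc n t) \<partial>lborel) =
      (\<integral>\<^sup>+t. (\<phi> t (walsh_rc n t) + \<phi> (t + ?h) (walsh_rc n (t + ?h))) * indicator ?A t \<partial>lborel)"
    by (rule nn_integral_dyadic_measurable)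
  also have "\<dots> = (\<integral>\<^sup>+t. (\<phi> t 1 + \<phi> t (- 1)) * indicator ?A t \<partial>lborel)"
    by (intro nn_integral_cong) (use pair in \<open>auto simp: indicator_def\<close>)
  finally have lhs: "(\<integral>\<^sup>+t. \<phi> t (walsh_rc n t) \<partial>lborel) = \<dots>" .
  have dm: "dyadic_measurable j (\<lambda>t. \<phi> t 1 + \<phi> t (- 1))"
    by (rule dyadic_measurable_compose2[where G = "(+)", OF \<phi> \<phi>])
  \<comment> \<open>Folding the right-hand side as well, whose integrand takes equal values on both
    cells of a pair, produces the factor 2.\<close>
  have "(\<integral>\<^sup>+t. \<phi> t 1 + \<phi> t (- 1) \<partial>lborel) =
    (\<integral>\<^sup>+t. ((\<phi> t 1 + \<phi> t (- 1)) + (\<phi> (t + ?h) 1 + \<phi> (t + ?h) (- 1))) * indicator ?A t \<partial>lborel)"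
    by (rule nn_integral_dyadic_measurable[OF dyadic_measurable_mono[OF dm le_SucI[OF order_refl]]])
  also have "\<dots> = (\<integral>\<^sup>+t. 2 * ((\<phi> t 1 + \<phi> t (- 1)) * indicator ?A t) \<partial>lborel)"
  proof (intro nn_integral_cong)
    fix t
    show "((\<phi> t 1 + \<phi> t (- 1)) + (\<phi> (t + ?h) 1 + \<phi> (t + ?h) (- 1))) * indicator ?A t
        = 2 * ((\<phi> t 1 + \<phi> t (- 1)) * indicator ?A t)"
    proof (cases "t \<in> ?A")
      case True
      have e: "\<phi> (t + ?h) 1 + \<phi> (t + ?h) (- 1) = \<phi> t 1 + \<phi> t (- 1)"
        by (rule dyadic_measurableD[OF dm cell[OF True]])
      show ?thesis
        unfolding e by (simp only: mult_2 distrib_right)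
    qed simp
  qed
  also have "\<dots> = 2 * (\<integral>\<^sup>+t. (\<phi> t 1 + \<phi> t (- 1)) * indicator ?A t \<partial>lborel)"
  proof (intro nn_integral_cmult)
    have [measurable]: "(\<lambda>t. \<phi> t 1 + \<phi> t (- 1)) \<in> borel_measurable borel"
      using dm by (rule borel_measurable_dyadic_measurable)
    show "(\<lambda>t. (\<phi> t 1 + \<phi> t (- 1)) * indicator ?A t) \<in> borel_measurable lborel"
      by measurable
  qed
  finally show ?thesis
    using lhs by simp
qed

section \<open>Exponential square integrability of lacunary sums\<close>

text \<open>Termwise comparison of power series, since \<open>fact (2 * n)\<close> is at least
  \<open>fact n * 2 ^ n\<close>.\<close>

lemma cosh_le_exp_half_square: "cosh x \<le> exp (x\<^sup>2 / 2)" for x :: real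
proof -
  have fact_ge: "fact n * 2 ^ n \<le> (fact (2 * n) :: real)" for n
  proof (induction n)
    case (Suc n)
    have "fact (Suc n) * 2 ^ Suc n = (2 * real n + 2) * (fact n * 2 ^ n)"
      by (simp add: algebra_simps)
    also have "\<dots> \<le> (2 * real n + 2) * ((2 * real n + 1) * fact (2 * n))"
      using Suc by (intro mult_left_mono order.trans[OF Suc]) (auto simp: mult_le_cancel_right1)
    also have "\<dots> = fact (2 * Suc n)"
      by (simp add: algebra_simps)
    finally show ?case .
  qed simp
  let ?c = "\<lambda>n. if even n then x ^ n /\<^sub>R fact n else 0"
  have "(\<lambda>n. ?c (2 * n)) sums cosh x"
    using cosh_converges[of x]
    by (subst sums_mono_reindex) (auto simp: strict_mono_def elim!: evenE)
  then have l: "(\<lambda>n. (x\<^sup>2) ^ n / fact (2 * n)) sums cosh x"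
    by (simp add: power_mult divide_inverse_commute[of _ "fact _"])
  have r: "(\<lambda>n. (x\<^sup>2 / 2) ^ n / fact n) sums exp (x\<^sup>2 / 2)"
    using exp_converges[of "x\<^sup>2 / 2"]
    by (simp only: real_scaleR_def divide_inverse_commute[of _ "fact _"])
  have "(x\<^sup>2) ^ n / fact (2 * n) \<le> (x\<^sup>2 / 2) ^ n / fact n" for n
  proof -
    have "(x\<^sup>2) ^ n / fact (2 * n) \<le> (x\<^sup>2) ^ n / (fact n * 2 ^ n)"
      using fact_ge[of n] by (intro divide_left_mono) auto
    then show ?thesis by (simp add: power_divide mult.commute)
  qed
  from sums_le[OF this l r] show ?thesis .
qed

text \<open>The mixed terms combine to \<open>cosh (2 * s * x * a)\<close>. Bounding this by an
  exponential of a multiple of \<open>x\<^sup>2\<close> merely raises the coefficient of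
  \<open>x\<^sup>2\<close> from \<open>s\<close> to
  \<open>s * (1 + 2 * s * a\<^sup>2)\<close>.\<close>

lemma exp_square_symmetric_le:
  fixes s x a :: real
  shows "exp (s * (x + a)\<^sup>2) + exp (s * (x - a)\<^sup>2) \<le> 2 * (exp (s * a\<^sup>2) * exp (s * (1 + 2 * s * a\<^sup>2) * x\<^sup>2))"
proof -
  have "exp (s * (x + a)\<^sup>2) + exp (s * (x - a)\<^sup>2) = 2 * (exp (s * x\<^sup>2 + s * a\<^sup>2) * cosh (2 * s * x * a))"
    by (simp add: cosh_field_def power2_eq_square algebra_simps flip: exp_add)
  also have "\<dots> \<le> 2 * (exp (s * x\<^sup>2 + s * a\<^sup>2) * exp ((2 * s * x * a)\<^sup>2 / 2))"
    by (intro mult_left_mono cosh_le_exp_half_square) auto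
  also have "\<dots> = 2 * (exp (s * a\<^sup>2) * exp (s * (1 + 2 * s * a\<^sup>2) * x\<^sup>2))"
    by (simp add: power2_eq_square algebra_simps flip: exp_add)
  finally show ?thesis .
qed

lemma dyadic_measurable_set_borel:
  assumes "dyadic_measurable j (\<lambda>t. t \<in> F)"
  shows "F \<in> sets borel"
proof -
  have "dyadic_measurable j (indicator F :: real \<Rightarrow> real)"
    unfolding indicator_def using assms by (rule dyadic_measurable_compose)
  then have "(indicator F :: real \<Rightarrow> real) \<in> borel_measurable borel"
    by (rule borel_measurable_dyadic_measurable)
  then show ?thesis
    by (simp add: borel_measurable_indicator_iff)
qed

text \<open>Averaging over the sign of the top Walsh function removes it. The price is a factor and
  a larger coefficient in the exponent, which an iteration has to track.\<close>

lemma nn_integral_exp_square_step: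
  assumes n: "2 ^ j \<le> n" "n < 2 ^ Suc j"
    and F: "dyadic_measurable j (\<lambda>t. t \<in> F)" and S: "dyadic_measurable j S"
  shows "(\<integral>\<^sup>+t\<in>F. exp (s * (S t + a * walsh_rc n t)\<^sup>2) \<partial>lborel)
    \<le> exp (s * a\<^sup>2) * (\<integral>\<^sup>+t\<in>F. exp (s * (1 + 2 * s * a\<^sup>2) * (S t)\<^sup>2) \<partial>lborel)"
proof -
  have [measurable]: "F \<in> sets borel" "S \<in> borel_measurable borel"
    using F S by (auto intro: dyadic_measurable_set_borel borel_measurable_dyadic_measurable)
  define \<phi> where "\<phi> t e = ennreal (exp (s * (S t + a * e)\<^sup>2)) * indicator F t" for t e
  have "dyadic_measurable j (\<lambda>t. \<phi> t e)" for e
    using dyadic_measurable_compose2[OF F S, of "\<lambda>b x. ennreal (exp (s * (x + a * e)\<^sup>2)) * of_bool b"]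
    by (simp add: \<phi>_def indicator_def of_bool_def)
  then have "2 * (\<integral>\<^sup>+t. \<phi> t (walsh_rc n t) \<partial>lborel) = (\<integral>\<^sup>+t. \<phi> t 1 + \<phi> t (- 1) \<partial>lborel)"
    by (rule nn_integral_walsh_rc_symmetric[OF n])
  also have "\<dots> \<le> (\<integral>\<^sup>+t. 2 * (exp (s * a\<^sup>2) * (ennreal (exp (s * (1 + 2 * s * a\<^sup>2) * (S t)\<^sup>2)) * indicator F t)) \<partial>lborel)"
  proof (intro nn_integral_mono)
    fix t
    have "ennreal (exp (s * (S t + a)\<^sup>2)) + ennreal (exp (s * (S t - a)\<^sup>2))
        \<le> ennreal (2 * (exp (s * a\<^sup>2) * exp (s * (1 + 2 * s * a\<^sup>2) * (S t)\<^sup>2)))"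
      using exp_square_symmetric_le[of s "S t" a] by (simp add: ennreal_leI flip: ennreal_plus)
    also have "\<dots> = 2 * (ennreal (exp (s * a\<^sup>2)) * ennreal (exp (s * (1 + 2 * s * a\<^sup>2) * (S t)\<^sup>2)))"
      by (simp add: ennreal_mult)
    finally show "\<phi> t 1 + \<phi> t (- 1)
        \<le> 2 * (exp (s * a\<^sup>2) * (ennreal (exp (s * (1 + 2 * s * a\<^sup>2) * (S t)\<^sup>2)) * indicator F t))"
      by (simp add: \<phi>_def indicator_def)
  qed
  also have "\<dots> = 2 * (exp (s * a\<^sup>2) * (\<integral>\<^sup>+t\<in>F. exp (s * (1 + 2 * s * a\<^sup>2) * (S t)\<^sup>2) \<partial>lborel))"
    by (simp add: nn_integral_cmult)
  finally show ?thesis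
    by (simp add: \<phi>_def ennreal_mult_le_mult_iff)
qed

text \<open>\<open>l\<close> is the position of the leading bit of \<open>p\<close>; whatever has
  rank \<open>j\<close> then also has rank \<open>l\<close>.\<close>

lemma dyadic_block:
  fixes p :: nat
  assumes "2 ^ j \<le> p"
  obtains l where "j \<le> l" "2 ^ l \<le> p" "p < 2 ^ Suc l"
proof -
  have "0 < p" using assms by (meson less_le_trans zero_less_numeral zero_less_power)
  then obtain l where l: "2 ^ l \<le> p" "p < 2 ^ Suc l"
    using ex_power_ivl1[of 2 p] by auto
  have "(2::nat) ^ j < 2 ^ Suc l" using assms l by linarith
  then have "j \<le> l"
    by (simp only: power_strict_increasing_iff[OF one_less_numeral_iff[THEN iffD2]] less_Suc_eq_le semiring_norm)
  then show thesis using l by (rule that)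
qed

text \<open>Induction removing the term of largest index. Since \<open>s\<close> grows to
  \<open>s'\<close> in each step, the induction runs over all \<open>s\<close>, and the budget
  \<open>4 * s * (\<Sum>i<K. (b i)\<^sup>2) \<le> 1\<close> has to survive the growth.\<close>

lemma nn_integral_exp_square_sum_le:
  assumes m: "\<And>i. 2 * m i \<le> m (Suc i)" "2 ^ j \<le> m 0"
    and F: "dyadic_measurable j (\<lambda>t. t \<in> F)"
    and s: "s \<ge> 0" "4 * s * (\<Sum>i<K. (b i)\<^sup>2) \<le> 1"
  shows "(\<integral>\<^sup>+t\<in>F. exp (s * (\<Sum>i<K. b i * walsh_rc (m i) t)\<^sup>2) \<partial>lborel)
    \<le> exp (2 * s * (\<Sum>i<K. (b i)\<^sup>2)) * emeasure lborel F"
  using s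
proof (induction K arbitrary: s)
  case 0
  have "F \<in> sets borel"
    using F by (rule dyadic_measurable_set_borel)
  then show ?case by simp
next
  case (Suc K)
  define A where "A = (\<Sum>i<K. (b i)\<^sup>2)"
  define S where "S t = (\<Sum>i<K. b i * walsh_rc (m i) t)" for t
  have "A \<ge> 0" by (simp add: A_def sum_nonneg)
  have below: "2 * m i \<le> m (i + Suc d)" for i d
    by (induction d) (use m(1) in \<open>auto intro: order.trans simp: le_trans[OF _ m(1)]\<close>)
  have ge: "2 ^ j \<le> m K"
    using below[of 0 "K - 1"] m(2) by (cases K) auto
  then obtain l where "j \<le> l" and l: "2 ^ l \<le> m K" "m K < 2 ^ Suc l"
    by (rule dyadic_block)
  have F': "dyadic_measurable l (\<lambda>t. t \<in> F)"
    using F \<open>j \<le> l\<close> by (rule dyadic_measurable_mono)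
  \<comment> \<open>From \<open>2 * m i \<le> m K\<close> and \<open>m K < 2 ^ Suc l\<close>, all
    earlier indices lie below the leading bit of \<open>m K\<close>, so the remaining sum has rank
    \<open>l\<close>.\<close>
  have "m i < 2 ^ l" if "i < K" for i
    using below[of i "K - Suc i"] that l by auto
  then have S': "dyadic_measurable l S"
    unfolding S_def
    by (intro dyadic_measurable_sum dyadic_measurable_compose[where G = "\<lambda>x. b _ * x"] dyadic_measurable_walsh_rc) auto
  define s' where "s' = s * (1 + 2 * s * (b K)\<^sup>2)"
  have c: "4 * s * A + 4 * s * (b K)\<^sup>2 \<le> 1"
    using Suc.prems by (simp add: A_def algebra_simps)
  have "4 * s * A \<le> 1"
    using c Suc.prems(1) by (smt (verit) mult_nonneg_nonneg zero_le_power2)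
  have s': "s' \<ge> 0"
    using Suc.prems by (simp add: s'_def)
  \<comment> \<open>The budget released by the removed term pays for the growth of \<open>s\<close>:
    with y = \<open>s * (b K)\<^sup>2\<close>, (1 - 4y)(1 + 2y) = 1 - 2y - 8y^2 is at most
    1.\<close>
  have "4 * s' * A = 4 * s * A * (1 + 2 * s * (b K)\<^sup>2)"
    by (simp add: s'_def)
  also have "\<dots> \<le> (1 - 4 * s * (b K)\<^sup>2) * (1 + 2 * s * (b K)\<^sup>2)"
    using c Suc.prems(1) by (intro mult_right_mono) auto
  also have "\<dots> = 1 - 2 * (s * (b K)\<^sup>2) - 8 * (s * (b K)\<^sup>2)\<^sup>2"
    by (simp add: algebra_simps power2_eq_square)
  also have "\<dots> \<le> 1"
    using Suc.prems(1) by (smt (verit) mult_nonneg_nonneg zero_le_power2)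
  finally have "4 * s' * A \<le> 1" .
  have "(\<integral>\<^sup>+t\<in>F. exp (s * (\<Sum>i<Suc K. b i * walsh_rc (m i) t)\<^sup>2) \<partial>lborel)
      \<le> exp (s * (b K)\<^sup>2) * (\<integral>\<^sup>+t\<in>F. exp (s' * (S t)\<^sup>2) \<partial>lborel)"
    using nn_integral_exp_square_step[OF l F' S', of s "b K"] by (simp add: S_def s'_def)
  also have "\<dots> \<le> exp (s * (b K)\<^sup>2) * (exp (2 * s' * A) * emeasure lborel F)"
    using Suc.IH[OF s'] \<open>4 * s' * A \<le> 1\<close> by (intro mult_left_mono) (auto simp: A_def S_def)
  also have "\<dots> = exp (s * (b K)\<^sup>2 + 2 * s' * A) * emeasure lborel F"
    by (simp add: exp_add ennreal_mult mult.assoc)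
  also have "\<dots> \<le> exp (2 * s * (\<Sum>i<Suc K. (b i)\<^sup>2)) * emeasure lborel F"
  proof (intro mult_right_mono ennreal_leI)
    \<comment> \<open>The growth of \<open>s\<close> adds at most \<open>s * (b K)\<^sup>2\<close>
      to the exponent; together with the factor already split off, this gives the constant
      2.\<close>
    have "2 * s' * A = 2 * s * A + (4 * s * A) * (s * (b K)\<^sup>2)"
      by (simp add: s'_def algebra_simps power2_eq_square)
    also have "\<dots> \<le> 2 * s * A + 1 * (s * (b K)\<^sup>2)"
      using \<open>4 * s * A \<le> 1\<close> Suc.prems(1) by (intro add_left_mono mult_right_mono) auto
    finally show "exp (s * (b K)\<^sup>2 + 2 * s' * A) \<le> exp (2 * s * (\<Sum>i<Suc K. (b i)\<^sup>2))"
      by (simp add: A_def algebra_simps)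
  qed auto
  finally show ?case .
qed

text \<open>Cauchy-Schwarz contributes one factor \<open>L\<close>; Jensen's inequality for
  \<open>exp\<close> with equal weights \<open>1 / L\<close> contributes the other.\<close>

lemma exp_square_sum_le:
  fixes T :: "nat \<Rightarrow> real"
  assumes "L > 0" "s \<ge> 0"
  shows "exp (s * (\<Sum>l<L. T l)\<^sup>2) \<le> (\<Sum>l<L. 1 / L * exp ((real L)\<^sup>2 * s * (T l)\<^sup>2))"
proof -
  have "(\<Sum>l<L. T l)\<^sup>2 \<le> (\<Sum>l<L. (T l)\<^sup>2) * real L"
    using sum_squared_le_sum_of_squares[of T "{..<L}"] by simp
  then have "s * (\<Sum>l<L. T l)\<^sup>2 \<le> s * ((\<Sum>l<L. (T l)\<^sup>2) * real L)"
    using assms by (intro mult_left_mono)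
  also have "\<dots> = (\<Sum>l<L. (1 / L) *\<^sub>R ((real L)\<^sup>2 * s * (T l)\<^sup>2))"
    using assms by (simp add: sum_distrib_left sum_distrib_right power2_eq_square mult_ac)
  finally have "exp (s * (\<Sum>l<L. T l)\<^sup>2) \<le> exp (\<Sum>l<L. (1 / L) *\<^sub>R ((real L)\<^sup>2 * s * (T l)\<^sup>2))"
    by simp
  also have "\<dots> \<le> (\<Sum>l<L. 1 / L * exp ((real L)\<^sup>2 * s * (T l)\<^sup>2))"
    using assms by (intro convex_on_sum[OF _ _ exp_convex]) auto
  finally show ?thesis .
qed

text \<open>Within a residue class modulo \<open>L\<close> the indices at least double, so each
  class obeys the preceding bound. Convexity recombines the classes, at the cost of
  \<open>(real L)\<^sup>2 * s\<close> in place of \<open>s\<close>. Cutting the sum at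
  \<open>K * L\<close> gives every class exactly \<open>K\<close> terms.\<close>

lemma nn_integral_exp_square_lacunary_le:
  assumes n: "\<And>k. 2 * n k \<le> n (k + L)" "\<And>k. 2 ^ j \<le> n k" and L: "L > 0"
    and F: "dyadic_measurable j (\<lambda>t. t \<in> F)"
    and a: "summable (\<lambda>k. (a k)\<^sup>2)"
    and s: "s \<ge> 0" "4 * (real L)\<^sup>2 * s * (\<Sum>k. (a k)\<^sup>2) \<le> 1"
  shows "(\<integral>\<^sup>+t\<in>F. exp (s * (\<Sum>k<K * L. a k * walsh_rc (n k) t)\<^sup>2) \<partial>lborel)
    \<le> exp (2 * (real L)\<^sup>2 * s * (\<Sum>k. (a k)\<^sup>2)) * emeasure lborel F"
proof -
  let ?\<sigma> = "\<Sum>k. (a k)\<^sup>2"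
  let ?s = "(real L)\<^sup>2 * s"
  have [measurable]: "F \<in> sets borel"
    using F by (rule dyadic_measurable_set_borel)
  define T where "T l t = (\<Sum>i<K. a (i * L + l) * walsh_rc (n (i * L + l)) t)" for l t
  have [measurable]: "T l \<in> borel_measurable borel" for l
    unfolding T_def by measurable
  have group: "(\<Sum>k<K * L. f k) = (\<Sum>l<L. \<Sum>i<K. f (i * L + l))" for f :: "nat \<Rightarrow> real"
  proof -
    have "(\<Sum>k<K * L. f k) = (\<Sum>i<K. \<Sum>l<L. f (i * L + l))"
      unfolding sum.nat_group[symmetric]
      by (simp add: sum.atLeastLessThan_shift_0[of _ "_ * L"] lessThan_atLeast0 add.commute)
    then show ?thesis
      by (subst sum.swap) 
  qed
  have Tb: "(\<integral>\<^sup>+t\<in>F. exp (?s * (T l t)\<^sup>2) \<partial>lborel) \<le> exp (2 * ?s * ?\<sigma>) * emeasure lborel F"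
    if "l < L" for l
  proof -
    let ?b = "\<Sum>i<K. (a (i * L + l))\<^sup>2"
    have "?b \<le> (\<Sum>l<L. \<Sum>i<K. (a (i * L + l))\<^sup>2)"
      using that by (intro member_le_sum[of l "{..<L}" "\<lambda>l. \<Sum>i<K. (a (i * L + l))\<^sup>2"]) (auto intro: sum_nonneg)
    also have "\<dots> = (\<Sum>k<K * L. (a k)\<^sup>2)"
      by (rule group[symmetric])
    also have "\<dots> \<le> ?\<sigma>"
      using a by (intro sum_le_suminf) auto
    finally have b: "?s * ?b \<le> ?s * ?\<sigma>"
      using s(1) by (intro mult_left_mono) auto
    have "(\<integral>\<^sup>+t\<in>F. exp (?s * (T l t)\<^sup>2) \<partial>lborel) \<le> exp (2 * ?s * ?b) * emeasure lborel F"
      unfolding T_def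
    proof (rule nn_integral_exp_square_sum_le[OF _ _ F])
      show "2 * n (i * L + l) \<le> n (Suc i * L + l)" for i
        using n(1)[of "i * L + l"] by (simp add: add_ac)
      show "2 ^ j \<le> n (0 * L + l)" by (rule n(2))
      show "0 \<le> ?s" using s by simp
      show "4 * ?s * ?b \<le> 1" using b s(2) by (simp add: mult.assoc)
    qed
    also have "\<dots> \<le> exp (2 * ?s * ?\<sigma>) * emeasure lborel F"
      using b by (intro mult_right_mono ennreal_leI) (auto simp: mult.assoc)
    finally show ?thesis .
  qed
  have "(\<integral>\<^sup>+t\<in>F. exp (s * (\<Sum>k<K * L. a k * walsh_rc (n k) t)\<^sup>2) \<partial>lborel)
      \<le> (\<integral>\<^sup>+t. (\<Sum>l<L. ennreal (1 / L) * (ennreal (exp (?s * (T l t)\<^sup>2)) * indicator F t)) \<partial>lborel)"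
  proof (intro nn_integral_mono)
    fix t
    have "ennreal (exp (s * (\<Sum>k<K * L. a k * walsh_rc (n k) t)\<^sup>2))
        \<le> ennreal (\<Sum>l<L. 1 / L * exp (?s * (T l t)\<^sup>2))"
      unfolding group T_def using L s(1) by (intro ennreal_leI exp_square_sum_le)
    also have "\<dots> = (\<Sum>l<L. ennreal (1 / L * exp (?s * (T l t)\<^sup>2)))"
      by (intro sum_ennreal[symmetric]) simp
    also have "\<dots> = (\<Sum>l<L. ennreal (1 / L) * ennreal (exp (?s * (T l t)\<^sup>2)))"
      by (intro sum.cong refl ennreal_mult) simp_all
    finally show "ennreal (exp (s * (\<Sum>k<K * L. a k * walsh_rc (n k) t)\<^sup>2)) * indicator F t
        \<le> (\<Sum>l<L. ennreal (1 / L) * (ennreal (exp (?s * (T l t)\<^sup>2)) * indicator F t))"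
      by (simp add: indicator_def)
  qed
  also have "\<dots> = (\<Sum>l<L. ennreal (1 / L) * (\<integral>\<^sup>+t\<in>F. exp (?s * (T l t)\<^sup>2) \<partial>lborel))"
    by (subst nn_integral_sum) (auto simp: nn_integral_cmult)
  also have "\<dots> \<le> (\<Sum>l<L. ennreal (1 / L) * (exp (2 * ?s * ?\<sigma>) * emeasure lborel F))"
    using Tb by (intro sum_mono mult_left_mono) auto
  also have "\<dots> = exp (2 * ?s * ?\<sigma>) * emeasure lborel F"
  proof -
    have "of_nat L * ennreal (1 / L) = 1"
      using L by (simp add: ennreal_of_nat_eq_real_of_nat flip: ennreal_mult)
    then show ?thesis
      by (simp add: mult.assoc[symmetric])
  qed
  finally show ?thesis
    by (simp add: mult.assoc)
qed

text \<open>Fatou's lemma on \<open>G\<close>; positivity of the integrand allows passing from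
  \<open>G\<close> to the larger dyadic set \<open>F\<close>, where the uniform bound is
  available.\<close>

lemma nn_integral_exp_square_limit_le:
  fixes u :: "nat \<Rightarrow> real \<Rightarrow> real" and f :: "real \<Rightarrow> real"
  assumes [measurable]: "\<And>k. u k \<in> borel_measurable borel" "G \<in> sets lebesgue"
    and lim: "AE t in lebesgue. t \<in> G \<longrightarrow> (\<lambda>k. u k t) \<longlonglongrightarrow> f t"
    and bound: "\<And>k. (\<integral>\<^sup>+t\<in>F. exp (s * (u k t)\<^sup>2) \<partial>lborel) \<le> C" and "G \<subseteq> F"
  shows "(\<integral>\<^sup>+t\<in>G. exp (s * (f t)\<^sup>2) \<partial>lebesgue) \<le> C"
proof -
  have [measurable]: "u k \<in> borel_measurable lebesgue" for k
    by (intro measurable_completion) simp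
  let ?v = "\<lambda>k t. ennreal (exp (s * (u k t)\<^sup>2)) * indicator G t"
  have "(\<integral>\<^sup>+t\<in>G. exp (s * (f t)\<^sup>2) \<partial>lebesgue) \<le> (\<integral>\<^sup>+t. liminf (\<lambda>k. ?v k t) \<partial>lebesgue)"
  proof (intro nn_integral_mono_AE, use lim in eventually_elim)
    fix t assume t: "t \<in> G \<longrightarrow> (\<lambda>k. u k t) \<longlonglongrightarrow> f t"
    show "ennreal (exp (s * (f t)\<^sup>2)) * indicator G t \<le> liminf (\<lambda>k. ?v k t)"
    proof (cases "t \<in> G")
      case True
      with t have "(\<lambda>k. ennreal (exp (s * (u k t)\<^sup>2))) \<longlonglongrightarrow> ennreal (exp (s * (f t)\<^sup>2))"
        by (intro tendsto_intros tendsto_ennrealI) auto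
      from lim_imp_Liminf[OF _ this] show ?thesis
        using True by simp
    qed simp
  qed
  also have "\<dots> \<le> liminf (\<lambda>k. \<integral>\<^sup>+t. ?v k t \<partial>lebesgue)"
    by (intro nn_integral_liminf) measurable
  also have "\<dots> \<le> liminf (\<lambda>k. C)"
  proof (intro Liminf_mono always_eventually allI)
    fix k
    have "(\<integral>\<^sup>+t. ?v k t \<partial>lebesgue) \<le> (\<integral>\<^sup>+t\<in>F. exp (s * (u k t)\<^sup>2) \<partial>lebesgue)"
      using \<open>G \<subseteq> F\<close> by (intro nn_integral_mono) (auto simp: indicator_def)
    also have "\<dots> \<le> C"
      using bound by (simp add: nn_integral_completion)
    finally show "(\<integral>\<^sup>+t. ?v k t \<partial>lebesgue) \<le> C" .
  qed
  also have "\<dots> = C"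
    by (simp add: Liminf_const)
  finally show ?thesis .
qed

section \<open>Orthogonality and dyadic approximation\<close>

text \<open>If \<open>n XOR m\<close> were below \<open>2 ^ j\<close>, all bits from position
  \<open>j\<close> on would agree, and hence the quotients.\<close>

lemma XOR_ge_power:
  fixes n m :: nat
  assumes "n div 2 ^ j \<noteq> m div 2 ^ j"
  shows "2 ^ j \<le> n XOR m"
proof (rule ccontr)
  assume "\<not> 2 ^ j \<le> n XOR m"
  then have "drop_bit j (n XOR m) = 0"
    by (simp add: drop_bit_eq_div)
  then have x: "drop_bit j n XOR drop_bit j m = 0"
    by simp
  have "drop_bit j n = drop_bit j m"
  proof (rule bit_eqI)
    fix i
    have "\<not> bit (drop_bit j n XOR drop_bit j m) i"
      unfolding x by simp
    then show "bit (drop_bit j n) i \<longleftrightarrow> bit (drop_bit j m) i"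
      by (simp only: bit_xor_iff) blast
  qed
  with assms show False
    by (simp add: drop_bit_eq_div)
qed

lemma abs_walsh_rc: "\<bar>walsh_rc n t\<bar> = 1"
  using walsh_rc_values[of n t] by auto

lemma integrable_walsh_rc_indicator:
  assumes "F \<in> sets borel" "emeasure lborel F < \<infinity>"
  shows "integrable lborel (\<lambda>t. walsh_rc p t * indicator F t)"
proof (rule Bochner_Integration.integrable_bound)
  show "integrable lborel (indicator F :: real \<Rightarrow> real)"
    using assms by simp
  show "AE t in lborel. norm (walsh_rc p t * indicator F t) \<le> norm (indicator F t :: real)"
    by (intro always_eventually) (auto simp: indicator_def abs_walsh_rc)
qed (use assms in measurable)

text \<open>The sign symmetry is stated for nonnegative integrands, so it is applied to
  \<open>1 + walsh_rc p t\<close>, whose integral over \<open>F\<close> turns out to be the measure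
  of \<open>F\<close>.\<close>

lemma integral_walsh_rc_eq_0:
  assumes p: "2 ^ j \<le> p" and F: "dyadic_measurable j (\<lambda>t. t \<in> F)" and fin: "emeasure lborel F < \<infinity>"
  shows "(\<integral>t. walsh_rc p t * indicator F t \<partial>lborel) = 0"
proof -
  have [measurable]: "F \<in> sets borel"
    using F by (rule dyadic_measurable_set_borel)
  obtain l where "j \<le> l" and l: "2 ^ l \<le> p" "p < 2 ^ Suc l"
    using p by (rule dyadic_block)
  have F': "dyadic_measurable l (\<lambda>t. t \<in> F)"
    using F \<open>j \<le> l\<close> by (rule dyadic_measurable_mono)
  have "dyadic_measurable l (\<lambda>t. ennreal (1 + e) * indicator F t)" for e
    unfolding indicator_def using F' by (rule dyadic_measurable_compose)
  then have "2 * (\<integral>\<^sup>+t. ennreal (1 + walsh_rc p t) * indicator F t \<partial>lborel)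
      = (\<integral>\<^sup>+t. ennreal (1 + 1) * indicator F t + ennreal (1 + - 1) * indicator F t \<partial>lborel)"
    by (rule nn_integral_walsh_rc_symmetric[OF l])
  also have "\<dots> = 2 * emeasure lborel F"
    by (simp add: nn_integral_cmult)
  finally have nn: "(\<integral>\<^sup>+t. ennreal (1 + walsh_rc p t) * indicator F t \<partial>lborel) = emeasure lborel F"
    by (simp add: ennreal_mult_cancel_left)
  have int: "integrable lborel (\<lambda>t. indicator F t :: real)" "integrable lborel (\<lambda>t. walsh_rc p t * indicator F t)"
    using fin by (auto intro: integrable_walsh_rc_indicator)
  have "(\<integral>t. indicator F t + walsh_rc p t * indicator F t \<partial>lborel)
      = enn2real (\<integral>\<^sup>+t. ennreal (indicator F t + walsh_rc p t * indicator F t) \<partial>lborel)"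
  proof (intro integral_eq_nn_integral always_eventually allI)
    show "0 \<le> indicator F t + walsh_rc p t * indicator F t" for t
      using abs_walsh_rc[of p t] by (auto simp: indicator_def)
  qed measurable
  also have "(\<integral>\<^sup>+t. ennreal (indicator F t + walsh_rc p t * indicator F t) \<partial>lborel) = emeasure lborel F"
    unfolding nn[symmetric] by (intro nn_integral_cong) (auto simp: indicator_def)
  finally show ?thesis
    using int by (simp add: measure_def)
qed

text \<open>Different indices lie in different blocks of length \<open>2 ^ j\<close>, so the product
  of two different terms is a multiple of a Walsh function of index at least \<open>2 ^ j\<close>,
  which has mean zero on \<open>F\<close>. Only the diagonal survives.\<close>

lemma nn_integral_square_walsh_sum:
  assumes gap: "\<And>k. n k + 2 ^ j \<le> n (Suc k)"
    and F: "dyadic_measurable j (\<lambda>t. t \<in> F)" and fin: "emeasure lborel F < \<infinity>"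
  shows "(\<integral>\<^sup>+t\<in>F. (\<Sum>k<K. a k * walsh_rc (n k) t)\<^sup>2 \<partial>lborel) = ennreal (measure lborel F * (\<Sum>k<K. (a k)\<^sup>2))"
proof -
  have [measurable]: "F \<in> sets borel"
    using F by (rule dyadic_measurable_set_borel)
  have far: "n i + 2 ^ j \<le> n k" if "i < k" for i k
    using that
  proof (induction k)
    case (Suc k)
    then show ?case using gap[of k] by (cases "i = k") auto
  qed simp
  have "n i div 2 ^ j < n k div 2 ^ j" if "i < k" for i k
  proof -
    have "n i div 2 ^ j < (n i + 2 ^ j) div 2 ^ j" by simp
    also have "\<dots> \<le> n k div 2 ^ j" using far[OF that] by (rule div_le_mono)
    finally show ?thesis .
  qed
  then have ge: "2 ^ j \<le> n i XOR n k" if "i \<noteq> k" for i k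
    using that by (intro XOR_ge_power) (metis less_irrefl linorder_neqE_nat)
  have w0: "walsh_rc 0 t = 1" for t
    by (simp add: walsh_rc_def)
  have sq: "(\<Sum>k<K. a k * walsh_rc (n k) t)\<^sup>2 * indicator F t
      = (\<Sum>i<K. \<Sum>k<K. a i * a k * (walsh_rc (n i XOR n k) t * indicator F t))" for t
    unfolding power2_eq_square sum_product
    unfolding sum_distrib_right walsh_rc_mult[symmetric]
    by (intro sum.cong refl) (simp only: mult_ac)
  have int: "integrable lborel (\<lambda>t. walsh_rc p t * indicator F t)" for p
    using fin by (intro integrable_walsh_rc_indicator) auto
  have "(\<integral>t. walsh_rc (n i XOR n k) t * indicator F t \<partial>lborel) = (if k = i then measure lborel F else 0)" for i k
    using integral_walsh_rc_eq_0[OF ge F fin, of i k] by (auto simp: w0)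
  then have "(\<integral>t. (\<Sum>k<K. a k * walsh_rc (n k) t)\<^sup>2 * indicator F t \<partial>lborel)
      = (\<Sum>i<K. \<Sum>k<K. a i * a k * (if k = i then measure lborel F else 0))"
    unfolding sq using int by (simp add: Bochner_Integration.integral_sum)
  also have "\<dots> = measure lborel F * (\<Sum>k<K. (a k)\<^sup>2)"
    by (simp add: sum_distrib_left power2_eq_square mult_ac if_distrib cong: if_cong)
  finally have I: "(\<integral>t. (\<Sum>k<K. a k * walsh_rc (n k) t)\<^sup>2 * indicator F t \<partial>lborel) = \<dots>" .
  have "integrable lborel (\<lambda>t. (\<Sum>k<K. a k * walsh_rc (n k) t)\<^sup>2 * indicator F t)"
    unfolding sq using int by (intro Bochner_Integration.integrable_sum integrable_mult_right) auto
  then have "(\<integral>\<^sup>+t. ennreal ((\<Sum>k<K. a k * walsh_rc (n k) t)\<^sup>2 * indicator F t) \<partial>lborel)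
      = ennreal (measure lborel F * (\<Sum>k<K. (a k)\<^sup>2))"
    unfolding I[symmetric] by (intro nn_integral_eq_integral) auto
  then show ?thesis
    by (simp add: ennreal_mult' ennreal_indicator)
qed

lemma dyadic_measurable_unit_interval: "dyadic_measurable 0 (\<lambda>t. t \<in> {0..<1::real})"
proof -
  have "t \<in> {0..<1} \<longleftrightarrow> \<lfloor>t\<rfloor> = 0" for t :: real
    by (auto simp: floor_eq_iff)
  then show ?thesis
    by (simp add: dyadic_measurable_def)
qed

text \<open>Outer regularity gives an open \<open>U\<close> around \<open>E\<close> with small
  excess. The cells contained in \<open>U\<close> exhaust its part in the half-open unit interval as
  the rank grows, and continuity from below makes the remainder small.\<close>

lemma dyadic_approximation:
  assumes E: "E \<in> sets lebesgue" "E \<subseteq> {0..1}" and "\<delta> > 0"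
  obtains j F where "dyadic_measurable j (\<lambda>t. t \<in> F)" "F \<subseteq> {0..1}"
    "emeasure lebesgue (E - F) \<le> ennreal \<delta>" "emeasure lebesgue (F - E) \<le> ennreal \<delta>"
proof -
  obtain U where U: "open U" "E \<subseteq> U" "emeasure lebesgue (U - E) < ennreal \<delta>"
    using sets_lebesgue_outer_open[OF E(1) \<open>\<delta> > 0\<close>] by blast
  have [measurable]: "U \<in> sets borel" using U(1) by simp
  let ?I = "{0..<1::real}"
  define cell :: "nat \<Rightarrow> real \<Rightarrow> real set" where "cell j t = {s. \<lfloor>2 ^ j * s\<rfloor> = \<lfloor>2 ^ j * t\<rfloor>}" for j t
  define F where "F j = {t \<in> ?I. cell j t \<subseteq> U}" for j
  have F: "dyadic_measurable j (\<lambda>t. t \<in> F j)" for j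
  proof -
    have "dyadic_measurable j (cell j)"
      by (auto simp: dyadic_measurable_def cell_def)
    moreover have "dyadic_measurable j (\<lambda>t. t \<in> ?I)"
      using dyadic_measurable_unit_interval by (rule dyadic_measurable_mono) simp
    ultimately have "dyadic_measurable j (\<lambda>t. t \<in> ?I \<and> cell j t \<subseteq> U)"
      using dyadic_measurable_compose2[of j "\<lambda>t. t \<in> ?I" "cell j" "\<lambda>b c. b \<and> c \<subseteq> U"] by blast
    then show ?thesis by (simp add: F_def)
  qed
  have [measurable]: "F j \<in> sets borel" for j
    using F by (rule dyadic_measurable_set_borel)
  have "cell k t \<subseteq> cell j t" if "j \<le> k" for j k t
  proof -
    have "dyadic_measurable j (\<lambda>t. \<lfloor>2 ^ j * t\<rfloor>)"
      by (simp add: dyadic_measurable_def)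
    then have "dyadic_measurable k (\<lambda>t. \<lfloor>2 ^ j * t\<rfloor>)"
      using that by (rule dyadic_measurable_mono)
    then show ?thesis
      unfolding cell_def using dyadic_measurableD by blast
  qed
  then have "incseq F"
    unfolding incseq_def F_def by blast
  have UN: "(\<Union>j. F j) = U \<inter> ?I"
  proof (intro equalityI subsetI)
    fix t assume "t \<in> (\<Union>j. F j)"
    then show "t \<in> U \<inter> ?I" by (auto simp: F_def cell_def)
  next
    fix t assume t: "t \<in> U \<inter> ?I"
    then obtain e where e: "e > 0" "ball t e \<subseteq> U"
      using U(1) open_contains_ball by blast
    \<comment> \<open>Cells have length \<open>1 / 2 ^ j\<close>, so the cell of \<open>t\<close>
      fits into the ball.\<close>
    obtain j where j: "(1 / 2) ^ j < e"
      using real_arch_pow_inv[OF e(1), of "1 / 2"] by auto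
    have "s \<in> U" if "s \<in> cell j t" for s
    proof -
      have "\<bar>2 ^ j * s - 2 ^ j * t\<bar> < 1"
        using that unfolding cell_def by (simp add: abs_if) linarith
      then have "2 ^ j * \<bar>s - t\<bar> < 1"
        by (simp add: abs_mult flip: right_diff_distrib)
      then have "\<bar>s - t\<bar> < (1 / 2) ^ j"
        by (simp add: field_simps)
      then show ?thesis
        using e j by (auto simp: dist_real_def)
    qed
    then show "t \<in> (\<Union>j. F j)"
      using t by (auto simp: F_def)
  qed
  have finI: "emeasure lebesgue A < \<infinity>" if "A \<subseteq> ?I" for A
  proof -
    have "emeasure lebesgue A \<le> emeasure lebesgue ?I"
      using that by (intro emeasure_mono) auto
    then show ?thesis by (simp add: order.strict_trans1)
  qed
  have "(\<lambda>j. measure lebesgue (F j)) \<longlonglongrightarrow> measure lebesgue (\<Union>j. F j)"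
    using \<open>incseq F\<close> finI[of "U \<inter> ?I"] by (intro Lim_measure_incseq) (auto simp: UN)
  then have "\<forall>\<^sub>F j in sequentially. measure lebesgue (U \<inter> ?I) - \<delta> < measure lebesgue (F j)"
    using \<open>\<delta> > 0\<close> by (intro order_tendstoD) (auto simp: UN)
  then obtain j where j: "measure lebesgue (U \<inter> ?I) - \<delta> < measure lebesgue (F j)"
    by (auto dest: eventually_happens)
  have sub: "F j \<subseteq> U \<inter> ?I"
    using UN by blast
  have "measure lebesgue (U \<inter> ?I - F j) \<le> \<delta>"
    using j sub finI[of "U \<inter> ?I"] by (subst measure_Diff) auto
  then have small: "emeasure lebesgue (U \<inter> ?I - F j) \<le> ennreal \<delta>"
    using finI[OF Diff_subset[THEN order.trans, OF Int_lower2], of U "F j"]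
    by (subst emeasure_eq_ennreal_measure) (auto intro: ennreal_leI)
  \<comment> \<open>The point 1 may belong to \<open>E\<close> but not to the half-open interval; it
    has measure zero.\<close>
  have "emeasure lebesgue (E - F j) \<le> emeasure lebesgue ((U \<inter> ?I - F j) \<union> {1})"
    using E U by (intro emeasure_mono) auto
  also have "\<dots> \<le> emeasure lebesgue (U \<inter> ?I - F j) + emeasure lebesgue {1::real}"
    by (intro emeasure_subadditive) auto
  finally have "emeasure lebesgue (E - F j) \<le> ennreal \<delta>"
    using small by simp
  moreover have "emeasure lebesgue (F j - E) \<le> emeasure lebesgue (U - E)"
    using sub E by (intro emeasure_mono) auto
  then have "emeasure lebesgue (F j - E) \<le> ennreal \<delta>"
    using U(3) by simp
  moreover have "F j \<subseteq> {0..1}"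
    using sub by auto
  ultimately show thesis
    by (intro that[OF F[of j]])
qed

section \<open>Limits in the mean and almost everywhere convergent subsequences\<close>

lemma nn_integral_tendsto_0_AE_subseq:
  fixes u :: "nat \<Rightarrow> 'a \<Rightarrow> real"
  assumes [measurable]: "\<And>k. u k \<in> borel_measurable M" and nonneg: "\<And>k x. 0 \<le> u k x"
    and lim: "(\<lambda>k. \<integral>\<^sup>+x. ennreal (u k x) \<partial>M) \<longlonglongrightarrow> 0"
  obtains r where "AE x in M. (\<lambda>k. u (r k) x) \<longlonglongrightarrow> 0"
proof -
  have "\<forall>\<^sub>F k in sequentially. (\<integral>\<^sup>+x. ennreal (u k x) \<partial>M) < top"
    using lim by (rule order_tendstoD) simp
  then obtain N where N: "(\<integral>\<^sup>+x. ennreal (u k x) \<partial>M) < top" if "N \<le> k" for k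
    by (auto simp: eventually_sequentially)
  \<comment> \<open>Early integrals may be infinite; the shift by \<open>N\<close> leaves integrable
    functions, for which convergence in L1 yields an almost everywhere convergent
    subsequence.\<close>
  have int: "integrable M (u (k + N))" for k
    using N[of "k + N"] nonneg by (intro integrableI_nonneg) auto
  have "(\<integral>x. norm (u (k + N) x) \<partial>M) = enn2real (\<integral>\<^sup>+x. ennreal (u (k + N) x) \<partial>M)" for k
    using nonneg by (simp add: integral_eq_nn_integral)
  moreover have "(\<lambda>k. \<integral>\<^sup>+x. ennreal (u (k + N) x) \<partial>M) \<longlonglongrightarrow> 0"
    using lim by (rule LIMSEQ_ignore_initial_segment)
  then have "(\<lambda>k. enn2real (\<integral>\<^sup>+x. ennreal (u (k + N) x) \<partial>M)) \<longlonglongrightarrow> enn2real 0"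
    by (intro tendsto_enn2real) auto
  ultimately have "(\<lambda>k. \<integral>x. norm (u (k + N) x) \<partial>M) \<longlonglongrightarrow> 0"
    by simp
  from tendsto_L1_AE_subseq[OF int this] obtain r
    where "AE x in M. (\<lambda>k. u (r k + N) x) \<longlonglongrightarrow> 0" by blast
  then show thesis by (rule that)
qed

lemma L2_limit_AE_subseq:
  fixes u :: "nat \<Rightarrow> real \<Rightarrow> real" and g :: "real \<Rightarrow> real"
  assumes [measurable]: "\<And>k. u k \<in> borel_measurable lebesgue" "g \<in> borel_measurable lebesgue" "I \<in> sets lebesgue"
    and lim: "(\<lambda>k. \<integral>\<^sup>+t\<in>I. ennreal ((g t - u k t)\<^sup>2) \<partial>lebesgue) \<longlonglongrightarrow> 0"
  obtains r where "AE t in lebesgue. t \<in> I \<longrightarrow> (\<lambda>k. u (r k) t) \<longlonglongrightarrow> g t"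
proof -
  have "(\<lambda>k. \<integral>\<^sup>+t. ennreal ((g t - u k t)\<^sup>2 * indicator I t) \<partial>lebesgue) \<longlonglongrightarrow> 0"
    using lim by (simp add: ennreal_mult' ennreal_indicator)
  then obtain r where r: "AE t in lebesgue. (\<lambda>k. (g t - u (r k) t)\<^sup>2 * indicator I t) \<longlonglongrightarrow> 0"
    by (rule nn_integral_tendsto_0_AE_subseq[rotated 2]) auto
  have "AE t in lebesgue. t \<in> I \<longrightarrow> (\<lambda>k. u (r k) t) \<longlonglongrightarrow> g t"
  proof (rule eventually_mono[OF r], intro impI)
    fix t assume "(\<lambda>k. (g t - u (r k) t)\<^sup>2 * indicator I t) \<longlonglongrightarrow> 0" "t \<in> I"
    then have "(\<lambda>k. (g t - u (r k) t)\<^sup>2) \<longlonglongrightarrow> 0"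
      by simp
    from tendsto_real_sqrt[OF this] have "(\<lambda>k. \<bar>g t - u (r k) t\<bar>) \<longlonglongrightarrow> 0"
      by simp
    then have "(\<lambda>k. g t - u (r k) t) \<longlonglongrightarrow> 0"
      by (rule tendsto_rabs_zero_cancel)
    from tendsto_diff[OF tendsto_const[of "g t"] this] show "(\<lambda>k. u (r k) t) \<longlonglongrightarrow> g t"
      by simp
  qed
  then show thesis by (rule that)
qed

text \<open>Orthogonality computes the square integral of each partial sum over \<open>F\<close>
  exactly. Passing to \<open>g\<close> costs the factor 2 and an error that is bounded by the L2
  error on the unit interval and vanishes in the limit.\<close>

lemma sum_squares_le_nn_integral_limit:
  fixes g :: "real \<Rightarrow> real"
  assumes [measurable]: "g \<in> borel_measurable lebesgue"
    and lim: "(\<lambda>K. \<integral>\<^sup>+t\<in>{0..1}. ennreal ((g t - (\<Sum>k<K. a k * walsh_rc (n k) t))\<^sup>2) \<partial>lebesgue) \<longlonglongrightarrow> 0"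
    and gap: "\<And>k. n k + 2 ^ j \<le> n (Suc k)"
    and F: "dyadic_measurable j (\<lambda>t. t \<in> F)" "F \<subseteq> {0..1}"
    and a: "summable (\<lambda>k. (a k)\<^sup>2)"
  shows "ennreal (measure lebesgue F * (\<Sum>k. (a k)\<^sup>2)) \<le> 2 * (\<integral>\<^sup>+t\<in>F. ennreal ((g t)\<^sup>2) \<partial>lebesgue)"
proof -
  define S where "S K t = (\<Sum>k<K. a k * walsh_rc (n k) t)" for K t
  have [measurable]: "S K \<in> borel_measurable lebesgue" for K
    unfolding S_def by (intro measurable_completion) simp
  have Fb: "F \<in> sets borel"
    using F(1) by (rule dyadic_measurable_set_borel)
  then have [measurable]: "F \<in> sets lebesgue" by simp
  have "emeasure lborel F \<le> emeasure lborel {0..1::real}"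
    using F(2) by (intro emeasure_mono) auto
  then have fin: "emeasure lborel F < \<infinity>" by (simp add: order.strict_trans1)
  have K: "ennreal (measure lebesgue F * (\<Sum>k<K. (a k)\<^sup>2))
      \<le> 2 * (\<integral>\<^sup>+t\<in>F. ennreal ((g t)\<^sup>2) \<partial>lebesgue) + 2 * (\<integral>\<^sup>+t\<in>{0..1}. ennreal ((g t - S K t)\<^sup>2) \<partial>lebesgue)" for K
  proof -
    have "ennreal (measure lebesgue F * (\<Sum>k<K. (a k)\<^sup>2)) = (\<integral>\<^sup>+t\<in>F. ennreal ((S K t)\<^sup>2) \<partial>lebesgue)"
      using nn_integral_square_walsh_sum[where K = K and a = a and n = n and j = j and F = F, OF gap F(1) fin] Fb
      by (simp add: S_def nn_integral_completion)
    also have "\<dots> \<le> (\<integral>\<^sup>+t. 2 * (ennreal ((g t)\<^sup>2) * indicator F t) + 2 * (ennreal ((g t - S K t)\<^sup>2) * indicator {0..1} t) \<partial>lebesgue)"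
    proof (intro nn_integral_mono)
      fix t
      \<comment> \<open>The difference of the two sides is the square of
        \<open>2 * g t - S K t\<close>.\<close>
      have "(S K t)\<^sup>2 \<le> 2 * (g t)\<^sup>2 + 2 * (g t - S K t)\<^sup>2"
        using zero_le_power2[of "2 * g t - S K t"] by (simp add: power2_eq_square algebra_simps)
      then have "ennreal ((S K t)\<^sup>2) \<le> ennreal (2 * (g t)\<^sup>2 + 2 * (g t - S K t)\<^sup>2)"
        by (rule ennreal_leI)
      also have "\<dots> = 2 * ennreal ((g t)\<^sup>2) + 2 * ennreal ((g t - S K t)\<^sup>2)"
        by (simp add: ennreal_mult)
      finally show "ennreal ((S K t)\<^sup>2) * indicator F t
          \<le> 2 * (ennreal ((g t)\<^sup>2) * indicator F t) + 2 * (ennreal ((g t - S K t)\<^sup>2) * indicator {0..1} t)"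
        using F(2) by (auto simp: indicator_def)
    qed
    also have "\<dots> = 2 * (\<integral>\<^sup>+t\<in>F. ennreal ((g t)\<^sup>2) \<partial>lebesgue) + 2 * (\<integral>\<^sup>+t\<in>{0..1}. ennreal ((g t - S K t)\<^sup>2) \<partial>lebesgue)"
    proof -
      have [measurable]: "{0..1::real} \<in> sets lebesgue" by simp
      show ?thesis
        by (subst nn_integral_add) (measurable, simp add: nn_integral_cmult)
    qed
    finally show ?thesis .
  qed
  have "(\<lambda>K. \<Sum>k<K. (a k)\<^sup>2) \<longlonglongrightarrow> (\<Sum>k. (a k)\<^sup>2)"
    using a by (rule summable_LIMSEQ)
  then have l: "(\<lambda>K. ennreal (measure lebesgue F * (\<Sum>k<K. (a k)\<^sup>2))) \<longlonglongrightarrow> ennreal (measure lebesgue F * (\<Sum>k. (a k)\<^sup>2))"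
    by (intro tendsto_ennrealI tendsto_mult tendsto_const)
  have "(\<lambda>K. 2 * (\<integral>\<^sup>+t\<in>F. ennreal ((g t)\<^sup>2) \<partial>lebesgue) + 2 * (\<integral>\<^sup>+t\<in>{0..1}. ennreal ((g t - S K t)\<^sup>2) \<partial>lebesgue))
      \<longlonglongrightarrow> 2 * (\<integral>\<^sup>+t\<in>F. ennreal ((g t)\<^sup>2) \<partial>lebesgue) + 2 * 0"
    using lim unfolding S_def by (intro tendsto_add tendsto_const ennreal_tendsto_cmult) auto
  from LIMSEQ_le[OF l this] K show ?thesis
    by simp
qed

section \<open>Estimates on arbitrary sets\<close>

lemma ennreal_mult_plus:
  assumes "0 \<le> x" "0 \<le> y" "0 \<le> z"
  shows "ennreal (x * y + z) = ennreal x * ennreal y + ennreal z"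
  using assms by (simp add: ennreal_mult)

lemma nn_integral_cmult_plus3:
  assumes [measurable]: "u \<in> borel_measurable M" "v \<in> borel_measurable M" "w \<in> borel_measurable M"
  shows "(\<integral>\<^sup>+x. b * u x + (c * v x + d * w x) \<partial>M)
    = b * (\<integral>\<^sup>+x. u x \<partial>M) + (c * (\<integral>\<^sup>+x. v x \<partial>M) + d * (\<integral>\<^sup>+x. w x \<partial>M))"
  by (simp add: nn_integral_add nn_integral_cmult)

lemma ennreal_mult_plus3:
  assumes "0 \<le> x" "0 \<le> x'" "0 \<le> y" "0 \<le> y'" "0 \<le> z" "0 \<le> z'"
  shows "ennreal x * ennreal x' + (ennreal y * ennreal y' + ennreal z * ennreal z')
    = ennreal (x * x' + (y * y' + z * z'))"
  using assms by (simp add: ennreal_mult)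

text \<open>The partial sums along multiples of \<open>L\<close> are uniformly bounded in the
  exponential sense, and a subsequence of them converges to \<open>g\<close> almost everywhere, so
  Fatou's lemma applies.\<close>

lemma nn_integral_exp_square_L2_limit_le:
  fixes g :: "real \<Rightarrow> real"
  assumes n: "\<And>k. 2 * n k \<le> n (k + L)" "\<And>k. 2 ^ j \<le> n k" and L: "L > 0"
    and a: "summable (\<lambda>k. (a k)\<^sup>2)"
    and g: "g \<in> borel_measurable lebesgue"
    and lim: "(\<lambda>K. \<integral>\<^sup>+t\<in>{0..1}. ennreal ((g t - (\<Sum>k<K. a k * walsh_rc (n k) t))\<^sup>2) \<partial>lebesgue) \<longlonglongrightarrow> 0"
    and F: "dyadic_measurable j (\<lambda>t. t \<in> F)"
    and G: "G \<in> sets lebesgue" "G \<subseteq> F" "G \<subseteq> {0..1}"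
    and s: "s \<ge> 0" "4 * (real L)\<^sup>2 * s * (\<Sum>k. (a k)\<^sup>2) \<le> 1"
  shows "(\<integral>\<^sup>+t\<in>G. exp (s * (g t)\<^sup>2) \<partial>lebesgue) \<le> exp (2 * (real L)\<^sup>2 * s * (\<Sum>k. (a k)\<^sup>2)) * emeasure lborel F"
proof -
  define S where "S K t = (\<Sum>k<K * L. a k * walsh_rc (n k) t)" for K t
  have Sb: "S K \<in> borel_measurable borel" for K
    unfolding S_def by measurable
  have Sl: "S K \<in> borel_measurable lebesgue" for K
    using Sb by (intro measurable_completion) simp
  have "filterlim (\<lambda>K. K * L) sequentially sequentially"
    using L by (intro filterlim_subseq) (auto simp: strict_mono_def)
  from filterlim_compose[OF lim this]
  have "(\<lambda>K. \<integral>\<^sup>+t\<in>{0..1}. ennreal ((g t - S K t)\<^sup>2) \<partial>lebesgue) \<longlonglongrightarrow> 0"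
    by (simp add: S_def)
  then obtain r where r: "AE t in lebesgue. t \<in> {0..1} \<longrightarrow> (\<lambda>k. S (r k) t) \<longlonglongrightarrow> g t"
    by (rule L2_limit_AE_subseq[rotated 3]) (use Sl g in auto)
  show ?thesis
  proof (rule nn_integral_exp_square_limit_le[where u = "\<lambda>k. S (r k)" and F = F])
    show "AE t in lebesgue. t \<in> G \<longrightarrow> (\<lambda>k. S (r k) t) \<longlonglongrightarrow> g t"
      by (rule eventually_mono[OF r]) (use G(3) in blast)
    show "(\<integral>\<^sup>+t\<in>F. exp (s * (S (r k) t)\<^sup>2) \<partial>lborel)
        \<le> exp (2 * (real L)\<^sup>2 * s * (\<Sum>k. (a k)\<^sup>2)) * emeasure lborel F" for k
      unfolding S_def by (rule nn_integral_exp_square_lacunary_le[where n = n and L = L and j = j and a = a and F = F, OF n L F a s])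
  qed (use Sb G in auto)
qed

text \<open>The closed unit interval is not a union of cells, so it is enlarged to
  \<open>{0..<2}\<close>, whose length is the factor 2.\<close>

lemma nn_integral_exp_square_unit_interval_le:
  fixes g :: "real \<Rightarrow> real"
  assumes n: "\<And>k. 2 * n k \<le> n (k + L)" "\<And>k. 2 ^ j \<le> n k" and L: "L > 0"
    and a: "summable (\<lambda>k. (a k)\<^sup>2)"
    and g: "g \<in> borel_measurable lebesgue"
    and lim: "(\<lambda>K. \<integral>\<^sup>+t\<in>{0..1}. ennreal ((g t - (\<Sum>k<K. a k * walsh_rc (n k) t))\<^sup>2) \<partial>lebesgue) \<longlonglongrightarrow> 0"
    and s: "s \<ge> 0" "4 * (real L)\<^sup>2 * s * (\<Sum>k. (a k)\<^sup>2) \<le> 1"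
  shows "(\<integral>\<^sup>+t\<in>{0..1}. exp (s * (g t)\<^sup>2) \<partial>lebesgue) \<le> exp (2 * (real L)\<^sup>2 * s * (\<Sum>k. (a k)\<^sup>2)) * 2"
proof -
  have "t \<in> {0..<2} \<longleftrightarrow> \<lfloor>t\<rfloor> \<in> {0, 1}" for t :: real
    by (auto simp: floor_eq_iff)
  then have "dyadic_measurable 0 (\<lambda>t. t \<in> {0..<2::real})"
    by (simp only: dyadic_measurable_def power_0 mult_1) simp
  then have "dyadic_measurable j (\<lambda>t. t \<in> {0..<2::real})"
    by (rule dyadic_measurable_mono) simp
  moreover have "{0..1} \<subseteq> {0..<2::real}"
    by auto
  ultimately show ?thesis
    using nn_integral_exp_square_L2_limit_le[where n = n and L = L and j = j and a = a, OF n L a g lim _ _ _ _ s, of "{0..<2}" "{0..1}"]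
    by (simp add: ennreal_mult)
qed

text \<open>On \<open>E \<inter> F\<close> the exponential bound over \<open>F\<close> applies, and
  \<open>F\<close> is hardly larger than \<open>E\<close>. On \<open>E - F\<close> the exponential
  is dominated by a small multiple of its square, controlled on the whole unit interval, plus a
  constant that the small measure absorbs.\<close>

lemma nn_integral_M2_le_measure:
  fixes g :: "real \<Rightarrow> real"
  assumes n: "\<And>k. 2 * n k \<le> n (k + L)" "\<And>k. 2 ^ j \<le> n k" and L: "L > 0"
    and a: "summable (\<lambda>k. (a k)\<^sup>2)"
    and g: "g \<in> borel_measurable lebesgue"
    and lim: "(\<lambda>K. \<integral>\<^sup>+t\<in>{0..1}. ennreal ((g t - (\<Sum>k<K. a k * walsh_rc (n k) t))\<^sup>2) \<partial>lebesgue) \<longlonglongrightarrow> 0"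
    and F: "dyadic_measurable j (\<lambda>t. t \<in> F)" "F \<subseteq> {0..1}"
    and E: "E \<in> sets lebesgue" "E \<subseteq> {0..1}" "\<mu> = measure lebesgue E" "\<mu> > 0"
    and \<delta>: "emeasure lebesgue (E - F) \<le> ennreal \<delta>" "emeasure lebesgue (F - E) \<le> ennreal \<delta>"
      "0 \<le> \<delta>" "\<delta> \<le> \<mu>\<^sup>2 / 64" "\<delta> \<le> \<mu> / 64"
    and c: "c > 0" "4 * L * sqrt (\<Sum>k. (a k)\<^sup>2) \<le> c"
  shows "(\<integral>\<^sup>+t\<in>E. ennreal (M2 (\<bar>g t\<bar> / c)) \<partial>lebesgue) \<le> ennreal \<mu>"
proof -
  let ?\<sigma> = "\<Sum>k. (a k)\<^sup>2"
  \<comment> \<open>With this choice \<open>exp (s * (g t)\<^sup>2)\<close> is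
    \<open>M2 (\<bar>g t\<bar> / c) + 1\<close>.\<close>
  define s where "s = 1 / c\<^sup>2"
  \<comment> \<open>Balances the two terms used on \<open>E - F\<close>, which then contribute at
    most 3/8 and 1/32 of \<open>\<mu>\<close>.\<close>
  define \<tau> where "\<tau> = \<mu> / 4"
  have "\<tau> > 0" using E by (simp add: \<tau>_def)
  have "?\<sigma> \<ge> 0" using a by (simp add: suminf_nonneg)
  have s: "s > 0" using c by (simp add: s_def)
  have "(4 * L * sqrt ?\<sigma>)\<^sup>2 \<le> c\<^sup>2"
    using c \<open>?\<sigma> \<ge> 0\<close> by (intro power_mono) auto
  \<comment> \<open>Leaves room for the exponential bound with coefficient \<open>2 * s\<close> as
    well as \<open>s\<close>, with resulting exponents at most 1/4 and 1/8.\<close>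
  then have s\<sigma>: "16 * ((real L)\<^sup>2 * s * ?\<sigma>) \<le> 1"
    using c \<open>?\<sigma> \<ge> 0\<close> by (simp add: s_def power_mult_distrib field_simps)
  have Fb: "F \<in> sets borel"
    using F(1) by (rule dyadic_measurable_set_borel)
  have [measurable]: "F \<in> sets lebesgue" "E \<in> sets lebesgue" "{0..1::real} \<in> sets lebesgue" "g \<in> borel_measurable lebesgue"
    using Fb E g by auto
  have finE: "emeasure lebesgue E = ennreal \<mu>"
  proof -
    have "emeasure lebesgue E \<le> emeasure lebesgue {0..1::real}"
      using E by (intro emeasure_mono) auto
    then show ?thesis
      unfolding E(3) by (intro emeasure_eq_ennreal_measure) (auto simp: top_unique)
  qed
  have "emeasure lebesgue F \<le> emeasure lebesgue (E \<union> (F - E))"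
    by (intro emeasure_mono) auto
  also have "\<dots> \<le> emeasure lebesgue E + emeasure lebesgue (F - E)"
    by (intro emeasure_subadditive) auto
  also have "\<dots> \<le> ennreal (\<mu> + \<delta>)"
    using \<delta> E(4) by (simp add: finE add_left_mono)
  finally have mF: "emeasure lborel F \<le> ennreal (\<mu> + \<delta>)"
    using Fb by simp
  have "(\<integral>\<^sup>+t\<in>E \<inter> F. exp (s * (g t)\<^sup>2) \<partial>lebesgue) \<le> exp (2 * (real L)\<^sup>2 * s * ?\<sigma>) * emeasure lborel F"
    using s s\<sigma> E by (intro nn_integral_exp_square_L2_limit_le[where n = n and L = L and j = j and a = a, OF n L a g lim F(1)]) (auto simp: mult_ac)
  also have "\<dots> \<le> ennreal (exp (1 / 8)) * ennreal (\<mu> + \<delta>)"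
    using s\<sigma> mF by (intro mult_mono ennreal_leI) (auto simp: mult_ac)
  finally have main: "(\<integral>\<^sup>+t\<in>E \<inter> F. exp (s * (g t)\<^sup>2) \<partial>lebesgue) \<le> \<dots>" .
  have "(\<integral>\<^sup>+t\<in>{0..1}. exp (2 * s * (g t)\<^sup>2) \<partial>lebesgue) \<le> exp (2 * (real L)\<^sup>2 * (2 * s) * ?\<sigma>) * 2"
    using s s\<sigma> \<open>?\<sigma> \<ge> 0\<close> by (intro nn_integral_exp_square_unit_interval_le[where n = n and L = L and j = j and a = a, OF n L a g lim]) (auto simp: mult_ac)
  also have "\<dots> \<le> ennreal (exp (1 / 4) * 2)"
    using s\<sigma> by (intro ennreal_leI mult_right_mono) (auto simp: mult_ac)
  finally have rest: "(\<integral>\<^sup>+t\<in>{0..1}. exp (2 * s * (g t)\<^sup>2) \<partial>lebesgue) \<le> \<dots>" .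
  have "(\<integral>\<^sup>+t\<in>E. exp (s * (g t)\<^sup>2) \<partial>lebesgue)
      \<le> (\<integral>\<^sup>+t. ennreal (exp (s * (g t)\<^sup>2)) * indicator (E \<inter> F) t
          + (ennreal (\<tau> / 2) * (ennreal (exp (2 * s * (g t)\<^sup>2)) * indicator {0..1} t)
          + ennreal (1 / (2 * \<tau>)) * indicator (E - F) t) \<partial>lebesgue)"
  proof (intro nn_integral_mono)
    fix t
    let ?e = "exp (s * (g t)\<^sup>2)"
    have "?e * ?e = exp (2 * s * (g t)\<^sup>2)"
      by (simp flip: exp_add)
    moreover have "2 * \<tau> * ?e \<le> \<tau>\<^sup>2 * (?e * ?e) + 1"
      using zero_le_power2[of "\<tau> * ?e - 1"] by (simp add: power2_eq_square algebra_simps)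
    ultimately have "?e \<le> \<tau> / 2 * exp (2 * s * (g t)\<^sup>2) + 1 / (2 * \<tau>)"
      using \<open>\<tau> > 0\<close> by (simp add: field_simps power2_eq_square)
    then have "ennreal ?e \<le> ennreal (\<tau> / 2 * exp (2 * s * (g t)\<^sup>2) + 1 / (2 * \<tau>))"
      by (rule ennreal_leI)
    also have "\<dots> = ennreal (\<tau> / 2) * ennreal (exp (2 * s * (g t)\<^sup>2)) + ennreal (1 / (2 * \<tau>))"
      using \<open>\<tau> > 0\<close> by (intro ennreal_mult_plus) auto
    finally show "ennreal ?e * indicator E t \<le> ennreal ?e * indicator (E \<inter> F) t
          + (ennreal (\<tau> / 2) * (ennreal (exp (2 * s * (g t)\<^sup>2)) * indicator {0..1} t)
          + ennreal (1 / (2 * \<tau>)) * indicator (E - F) t)"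
      using E(2) by (auto simp: indicator_def)
  qed
  also have "\<dots> = (\<integral>\<^sup>+t\<in>E \<inter> F. exp (s * (g t)\<^sup>2) \<partial>lebesgue)
      + (ennreal (\<tau> / 2) * (\<integral>\<^sup>+t\<in>{0..1}. exp (2 * s * (g t)\<^sup>2) \<partial>lebesgue)
      + ennreal (1 / (2 * \<tau>)) * emeasure lebesgue (E - F))"
    using nn_integral_cmult_plus3[where b = 1 and M = lebesgue
        and u = "\<lambda>t. ennreal (exp (s * (g t)\<^sup>2)) * indicator (E \<inter> F) t"
        and v = "\<lambda>t. ennreal (exp (2 * s * (g t)\<^sup>2)) * indicator {0..1} t"
        and w = "indicator (E - F)" and c = "ennreal (\<tau> / 2)" and d = "ennreal (1 / (2 * \<tau>))"]
    by simp
  also have "\<dots> \<le> ennreal (exp (1 / 8)) * ennreal (\<mu> + \<delta>)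
      + (ennreal (\<tau> / 2) * ennreal (exp (1 / 4) * 2) + ennreal (1 / (2 * \<tau>)) * ennreal \<delta>)"
    by (intro add_mono mult_left_mono main rest \<delta>) auto
  also have "\<dots> = ennreal (exp (1 / 8) * (\<mu> + \<delta>) + (\<tau> / 2 * (exp (1 / 4) * 2) + 1 / (2 * \<tau>) * \<delta>))"
    using \<open>\<tau> > 0\<close> \<delta>(3) E(4) by (intro ennreal_mult_plus3) auto
  also have "\<dots> \<le> ennreal (2 * \<mu>)"
  proof (intro ennreal_leI)
    have e: "exp (1 / 8 :: real) \<le> 5 / 4" "exp (1 / 4 :: real) \<le> 3 / 2"
      using exp_bound[of "1 / 8"] exp_bound[of "1 / 4"] by (auto simp: power2_eq_square)
    have "exp (1 / 8) * (\<mu> + \<delta>) \<le> 5 / 4 * (\<mu> + \<delta>)"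
      using \<delta>(3) E(4) by (intro mult_right_mono e) auto
    moreover have "\<tau> / 2 * (exp (1 / 4) * 2) \<le> \<tau> * (3 / 2)"
      using mult_left_mono[OF e(2), of \<tau>] \<open>\<tau> > 0\<close> by simp
    moreover have "1 / (2 * \<tau>) * \<delta> \<le> \<mu> / 32"
      using \<delta>(4) E(4) by (simp add: \<tau>_def field_simps power2_eq_square)
    ultimately have "exp (1 / 8) * (\<mu> + \<delta>) + (\<tau> / 2 * (exp (1 / 4) * 2) + 1 / (2 * \<tau>) * \<delta>)
        \<le> 5 / 4 * (\<mu> + \<delta>) + (\<tau> * (3 / 2) + \<mu> / 32)"
      by (intro add_mono)
    also have "\<dots> \<le> 2 * \<mu>"
      using \<delta>(5) E(4) by (simp add: \<tau>_def field_simps)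
    finally show "exp (1 / 8) * (\<mu> + \<delta>) + (\<tau> / 2 * (exp (1 / 4) * 2) + 1 / (2 * \<tau>) * \<delta>) \<le> 2 * \<mu>" .
  qed
  finally have total: "(\<integral>\<^sup>+t\<in>E. exp (s * (g t)\<^sup>2) \<partial>lebesgue) \<le> ennreal (2 * \<mu>)" .
  have M2: "M2 (\<bar>g t\<bar> / c) = exp (s * (g t)\<^sup>2) - 1" "exp (s * (g t)\<^sup>2) \<ge> 1" for t
    using s by (auto simp: M2_def s_def power_divide)
  have M3: "ennreal (exp (s * (g t)\<^sup>2) - 1) + 1 = ennreal (exp (s * (g t)\<^sup>2))" for t
    using ennreal_plus[of "exp (s * (g t)\<^sup>2) - 1" 1] M2(2)[of t] by simp
  \<comment> \<open>Adding \<open>\<mu>\<close>, the integral of 1 over \<open>E\<close>, reduces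
    the goal to the bound \<open>2 * \<mu>\<close> without subtraction in
    \<open>ennreal\<close>.\<close>
  have "(\<integral>\<^sup>+t\<in>E. ennreal (M2 (\<bar>g t\<bar> / c)) \<partial>lebesgue) + ennreal \<mu>
      = (\<integral>\<^sup>+t. ennreal (exp (s * (g t)\<^sup>2) - 1) * indicator E t + indicator E t \<partial>lebesgue)"
    unfolding M2(1) by (subst nn_integral_add) (auto simp: finE)
  also have "\<dots> = (\<integral>\<^sup>+t\<in>E. exp (s * (g t)\<^sup>2) \<partial>lebesgue)"
    by (intro nn_integral_cong) (simp add: indicator_def M3)
  also have "\<dots> \<le> ennreal \<mu> + ennreal \<mu>"
    using total E(4) by (simp flip: ennreal_plus)
  finally show ?thesis
    by simp
qed

text \<open>By orthogonality the square integral of \<open>g\<close> over \<open>F\<close> is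
  bounded below. On \<open>E\<close> the square is at most
  \<open>c\<^sup>2 * M2 (\<bar>g t\<bar> / c)\<close>, whose integral is at most
  \<open>c\<^sup>2 * \<mu>\<close>; the part over \<open>F - E\<close> is small by the global
  exponential bound. Hence \<open>c\<close> cannot be small.\<close>

lemma sqrt_sum_squares_le:
  fixes g :: "real \<Rightarrow> real"
  assumes n: "\<And>k. 2 * n k \<le> n (k + L)" "\<And>k. 2 ^ j \<le> n k" and L: "L > 0"
    and gap: "\<And>k. n k + 2 ^ j \<le> n (Suc k)"
    and a: "summable (\<lambda>k. (a k)\<^sup>2)"
    and g: "g \<in> borel_measurable lebesgue"
    and lim: "(\<lambda>K. \<integral>\<^sup>+t\<in>{0..1}. ennreal ((g t - (\<Sum>k<K. a k * walsh_rc (n k) t))\<^sup>2) \<partial>lebesgue) \<longlonglongrightarrow> 0"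
    and F: "dyadic_measurable j (\<lambda>t. t \<in> F)" "F \<subseteq> {0..1}"
    and E: "E \<in> sets lebesgue" "E \<subseteq> {0..1}" "\<mu> = measure lebesgue E" "\<mu> > 0"
    and \<delta>: "emeasure lebesgue (E - F) \<le> ennreal \<delta>" "emeasure lebesgue (F - E) \<le> ennreal \<delta>"
      "0 \<le> \<delta>" "\<delta> \<le> \<mu>\<^sup>2 / (4096 * real L ^ 4)" "\<delta> \<le> \<mu> / 64"
    and c: "c > 0" "(\<integral>\<^sup>+t\<in>E. ennreal (M2 (\<bar>g t\<bar> / c)) \<partial>lebesgue) \<le> ennreal \<mu>"
  shows "1 / 2 * sqrt (\<Sum>k. (a k)\<^sup>2) \<le> c"
proof (cases "(\<Sum>k. (a k)\<^sup>2) = 0")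
  case True
  then show ?thesis using c by simp
next
  case False
  define \<sigma> where "\<sigma> = (\<Sum>k. (a k)\<^sup>2)"
  have "\<sigma> \<ge> 0" using a by (simp add: \<sigma>_def suminf_nonneg)
  with False have "\<sigma> > 0" by (simp add: \<sigma>_def)
  \<comment> \<open>The largest coefficient that the exponential bound admits.\<close>
  define s where "s = 1 / (4 * (real L)\<^sup>2 * \<sigma>)"
  \<comment> \<open>Makes \<open>\<tau> / s\<close> equal to \<open>\<mu> * \<sigma> / 32\<close>,
    so the exponential term costs at most \<open>\<mu> * \<sigma> / 8\<close>. The other factor
    \<open>1 / (2 * \<tau> * s)\<close> becomes \<open>256 * real L ^ 4 * \<sigma> / \<mu>\<close>,
    and the constant 4096 in the bound on \<open>\<delta>\<close> reduces its cost to
    \<open>\<mu> * \<sigma> / 16\<close>.\<close>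
  define \<tau> where "\<tau> = \<mu> / (128 * (real L)\<^sup>2)"
  have "\<tau> > 0" "s > 0" using E L \<open>\<sigma> > 0\<close> by (auto simp: \<tau>_def s_def)
  have s\<sigma>: "4 * (real L)\<^sup>2 * s * \<sigma> = 1"
    using L \<open>\<sigma> > 0\<close> by (simp add: s_def)
  have Fb: "F \<in> sets borel"
    using F(1) by (rule dyadic_measurable_set_borel)
  have [measurable]: "F \<in> sets lebesgue" "E \<in> sets lebesgue" "{0..1::real} \<in> sets lebesgue" "g \<in> borel_measurable lebesgue"
    using Fb E g by auto
  have finI: "emeasure lebesgue A = ennreal (measure lebesgue A)" if "A \<subseteq> {0..1}" for A :: "real set"
  proof -
    have "emeasure lebesgue A \<le> emeasure lebesgue {0..1::real}"
      using that by (intro emeasure_mono) auto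
    then show ?thesis
      by (intro emeasure_eq_ennreal_measure) (auto simp: top_unique)
  qed
  have "emeasure lebesgue E \<le> emeasure lebesgue (F \<union> (E - F))"
    by (intro emeasure_mono) auto
  also have "\<dots> \<le> emeasure lebesgue F + emeasure lebesgue (E - F)"
    by (intro emeasure_subadditive) auto
  also have "\<dots> \<le> ennreal (measure lebesgue F) + ennreal \<delta>"
    unfolding finI[OF F(2)] by (intro add_left_mono \<delta>(1))
  finally have "ennreal \<mu> \<le> ennreal (measure lebesgue F + \<delta>)"
    unfolding finI[OF E(2)] E(3)[symmetric] ennreal_plus[OF measure_nonneg \<delta>(3)] .
  then have mF: "\<mu> \<le> measure lebesgue F + \<delta>"
    using \<delta>(3) by (subst (asm) ennreal_le_iff) auto
  have "(\<integral>\<^sup>+t\<in>{0..1}. exp (s * (g t)\<^sup>2) \<partial>lebesgue) \<le> exp (2 * (real L)\<^sup>2 * s * \<sigma>) * 2"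
    using \<open>s > 0\<close> s\<sigma> unfolding \<sigma>_def by (intro nn_integral_exp_square_unit_interval_le[where n = n and L = L and j = j and a = a, OF n L a g lim]) auto
  also have "2 * (real L)\<^sup>2 * s * \<sigma> = 1 / 2"
    using s\<sigma> by simp
  finally have rest: "(\<integral>\<^sup>+t\<in>{0..1}. exp (s * (g t)\<^sup>2) \<partial>lebesgue) \<le> ennreal (exp (1 / 2) * 2)" .
  have "ennreal (measure lebesgue F * \<sigma>) \<le> 2 * (\<integral>\<^sup>+t\<in>F. ennreal ((g t)\<^sup>2) \<partial>lebesgue)"
    unfolding \<sigma>_def by (rule sum_squares_le_nn_integral_limit[where n = n and j = j and a = a, OF g lim gap F a])
  also have "(\<integral>\<^sup>+t\<in>F. ennreal ((g t)\<^sup>2) \<partial>lebesgue)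
      \<le> (\<integral>\<^sup>+t. ennreal (c\<^sup>2) * (ennreal (M2 (\<bar>g t\<bar> / c)) * indicator E t)
          + (ennreal (\<tau> / s) * (ennreal (exp (s * (g t)\<^sup>2)) * indicator {0..1} t)
          + ennreal (1 / (2 * \<tau> * s)) * indicator (F - E) t) \<partial>lebesgue)"
  proof (intro nn_integral_mono)
    fix t
    let ?x = "s * (g t)\<^sup>2"
    have "1 + (g t)\<^sup>2 / c\<^sup>2 \<le> exp ((g t)\<^sup>2 / c\<^sup>2)"
      by (rule exp_ge_add_one_self)
    then have "(g t)\<^sup>2 \<le> c\<^sup>2 * M2 (\<bar>g t\<bar> / c)"
      using c(1) by (simp add: M2_def power_divide field_simps)
    then have "ennreal ((g t)\<^sup>2) \<le> ennreal (c\<^sup>2 * M2 (\<bar>g t\<bar> / c))"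
      by (rule ennreal_leI)
    also have "\<dots> = ennreal (c\<^sup>2) * ennreal (M2 (\<bar>g t\<bar> / c))"
      by (intro ennreal_mult) (auto simp: M2_def)
    finally have 1: "ennreal ((g t)\<^sup>2) \<le> \<dots>" .
    have "?x \<ge> 0" using \<open>s > 0\<close> by simp
    then have "?x\<^sup>2 \<le> 2 * exp ?x"
      using exp_lower_Taylor_quadratic[of ?x] by linarith
    then have "\<tau>\<^sup>2 * ?x\<^sup>2 \<le> \<tau>\<^sup>2 * (2 * exp ?x)"
      by (intro mult_left_mono) auto
    \<comment> \<open>Together with the Taylor bound for \<open>exp\<close>, this trades
      \<open>?x\<close> for a small multiple of \<open>exp ?x\<close> plus a constant.\<close>
    moreover have "2 * (\<tau> * ?x) \<le> (\<tau> * ?x)\<^sup>2 + 1"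
      using zero_le_power2[of "\<tau> * ?x - 1"] by (simp add: power2_diff)
    ultimately have "2 * \<tau> * ?x \<le> 2 * \<tau>\<^sup>2 * exp ?x + 1"
      by (simp add: power_mult_distrib)
    then have "(g t)\<^sup>2 \<le> \<tau> / s * exp ?x + 1 / (2 * \<tau> * s)"
      using \<open>\<tau> > 0\<close> \<open>s > 0\<close> by (simp add: field_simps power2_eq_square)
    then have "ennreal ((g t)\<^sup>2) \<le> ennreal (\<tau> / s * exp ?x + 1 / (2 * \<tau> * s))"
      by (rule ennreal_leI)
    also have "\<dots> = ennreal (\<tau> / s) * ennreal (exp ?x) + ennreal (1 / (2 * \<tau> * s))"
      using \<open>\<tau> > 0\<close> \<open>s > 0\<close> by (intro ennreal_mult_plus) auto
    finally have 2: "ennreal ((g t)\<^sup>2) \<le> \<dots>" .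
    show "ennreal ((g t)\<^sup>2) * indicator F t \<le> ennreal (c\<^sup>2) * (ennreal (M2 (\<bar>g t\<bar> / c)) * indicator E t)
          + (ennreal (\<tau> / s) * (ennreal (exp ?x) * indicator {0..1} t)
          + ennreal (1 / (2 * \<tau> * s)) * indicator (F - E) t)"
    proof (cases "t \<in> E")
      case True
      then show ?thesis
        using order.trans[OF 1 le_iff_add[THEN iffD2, OF exI, OF refl]] by (simp add: indicator_def)
    next
      case False
      then show ?thesis using 2 F(2) by (auto simp: indicator_def)
    qed
  qed
  also have "\<dots> = ennreal (c\<^sup>2) * (\<integral>\<^sup>+t\<in>E. ennreal (M2 (\<bar>g t\<bar> / c)) \<partial>lebesgue)
      + (ennreal (\<tau> / s) * (\<integral>\<^sup>+t\<in>{0..1}. exp (s * (g t)\<^sup>2) \<partial>lebesgue)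
      + ennreal (1 / (2 * \<tau> * s)) * emeasure lebesgue (F - E))"
    unfolding M2_def
    using nn_integral_cmult_plus3[where b = "ennreal (c\<^sup>2)" and M = lebesgue
        and u = "\<lambda>t. ennreal (exp ((\<bar>g t\<bar> / c)\<^sup>2) - 1) * indicator E t"
        and v = "\<lambda>t. ennreal (exp (s * (g t)\<^sup>2)) * indicator {0..1} t"
        and w = "indicator (F - E)" and c = "ennreal (\<tau> / s)" and d = "ennreal (1 / (2 * \<tau> * s))"]
    by simp
  also have "\<dots> \<le> ennreal (c\<^sup>2) * ennreal \<mu>
      + (ennreal (\<tau> / s) * ennreal (exp (1 / 2) * 2) + ennreal (1 / (2 * \<tau> * s)) * ennreal \<delta>)"
    by (intro add_mono mult_left_mono c rest \<delta>) auto
  also have "\<dots> = ennreal (c\<^sup>2 * \<mu> + (\<tau> / s * (exp (1 / 2) * 2) + 1 / (2 * \<tau> * s) * \<delta>))"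
    using \<open>\<tau> > 0\<close> \<open>s > 0\<close> \<delta>(3) E(4) by (intro ennreal_mult_plus3) auto
  finally have "ennreal (measure lebesgue F * \<sigma>) \<le> 2 * ennreal (c\<^sup>2 * \<mu> + (\<tau> / s * (exp (1 / 2) * 2) + 1 / (2 * \<tau> * s) * \<delta>))"
    by (simp add: mult_left_mono)
  also have "\<dots> = ennreal (2 * (c\<^sup>2 * \<mu> + (\<tau> / s * (exp (1 / 2) * 2) + 1 / (2 * \<tau> * s) * \<delta>)))"
    by (simp only: ennreal_mult'[of 2] ennreal_numeral zero_le_numeral)
  finally have "ennreal (measure lebesgue F * \<sigma>) \<le> \<dots>" .
  then have le: "measure lebesgue F * \<sigma> \<le> 2 * (c\<^sup>2 * \<mu> + (\<tau> / s * (exp (1 / 2) * 2) + 1 / (2 * \<tau> * s) * \<delta>))"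
    using \<open>\<tau> > 0\<close> \<open>s > 0\<close> \<delta>(3) E(4) by (subst (asm) ennreal_le_iff) auto
  have \<tau>s: "\<tau> / s = \<mu> * \<sigma> / 32"
    using L by (simp add: \<tau>_def s_def)
  have "exp (1 / 2 :: real) * 2 \<le> 4"
    using exp_bound[of "1 / 2"] by (auto simp: power2_eq_square)
  then have "\<mu> * \<sigma> / 32 * (exp (1 / 2) * 2) \<le> \<mu> * \<sigma> / 32 * 4"
    using E(4) \<open>\<sigma> > 0\<close> by (intro mult_left_mono) auto
  then have t1: "\<tau> / s * (exp (1 / 2) * 2) \<le> \<mu> * \<sigma> / 8"
    unfolding \<tau>s by simp
  have "1 / (2 * \<tau> * s) = 256 * real L ^ 4 * \<sigma> / \<mu>"
    using L by (simp add: \<tau>_def s_def field_simps power2_eq_square power4_eq_xxxx)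
  then have "1 / (2 * \<tau> * s) * \<delta> \<le> 256 * real L ^ 4 * \<sigma> / \<mu> * (\<mu>\<^sup>2 / (4096 * real L ^ 4))"
    using \<delta>(4) E(4) \<open>\<sigma> > 0\<close> by (simp only:) (intro mult_left_mono, auto)
  also have "\<dots> = \<mu> * \<sigma> / 16"
    using L E(4) by (simp add: field_simps power2_eq_square)
  finally have t2: "1 / (2 * \<tau> * s) * \<delta> \<le> \<mu> * \<sigma> / 16" .
  have "7 / 8 * \<mu> \<le> measure lebesgue F"
    using mF \<delta>(5) E(4) by linarith
  then have "7 / 8 * \<mu> * \<sigma> \<le> measure lebesgue F * \<sigma>"
    using \<open>\<sigma> > 0\<close> by (intro mult_right_mono) auto
  moreover have "measure lebesgue F * \<sigma> \<le> 2 * (c\<^sup>2 * \<mu> + (\<mu> * \<sigma> / 8 + \<mu> * \<sigma> / 16))"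
    by (rule order.trans[OF le]) (intro mult_left_mono add_left_mono add_mono t1 t2, simp)
  ultimately have "7 / 8 * \<mu> * \<sigma> \<le> 2 * (c\<^sup>2 * \<mu> + (\<mu> * \<sigma> / 8 + \<mu> * \<sigma> / 16))"
    by (rule order.trans)
  \<comment> \<open>The error terms on the right amount to 3/8 of \<open>\<mu> * \<sigma>\<close>;
    moving them to the left leaves one half there.\<close>
  then have "\<mu> * \<sigma> \<le> \<mu> * (4 * c\<^sup>2)"
    by (simp add: field_simps)
  then have "\<sigma> \<le> (2 * c)\<^sup>2"
    using E(4) by (simp add: power_mult_distrib)
  then have "sqrt \<sigma> \<le> 2 * c"
    using c(1) by (intro real_le_lsqrt) auto
  then show ?thesis
    by (simp add: \<sigma>_def)
qed

section \<open>From lacunarity to the conditions on the indices, and the final assembly\<close>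

lemma lacunary_power_le:
  assumes "lacunary q n" "q > 1"
  shows "q ^ i * real (n k) \<le> real (n (k + i))"
proof (induction i)
  case (Suc i)
  have "q \<le> real (n (Suc (k + i))) / real (n (k + i))"
    using assms(1) by (simp add: lacunary_def)
  \<comment> \<open>A zero denominator would make the quotient 0, contradicting
    \<open>q > 1\<close>.\<close>
  moreover from this have "real (n (k + i)) > 0"
    using assms(2) by (cases "n (k + i) = 0") auto
  ultimately have "q * real (n (k + i)) \<le> real (n (k + Suc i))"
    by (simp add: field_simps)
  moreover have "q * (q ^ i * real (n k)) \<le> q * real (n (k + i))"
    using Suc assms(2) by (intro mult_left_mono) auto
  ultimately show ?case by (simp add: mult.assoc)
qed simp

text \<open>Measurability of \<open>f\<close> is given relative to the unit interval, so
  \<open>f\<close> is extended by 0. Replacing \<open>walsh\<close> by \<open>walsh_rc\<close>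
  changes the integrands only on a null set.\<close>

lemma is_L2_sum_walsh_rc:
  assumes "is_L2_sum a n f"
  defines "g \<equiv> \<lambda>t. if t \<in> {0..1} then f t else 0"
  shows "g \<in> borel_measurable lebesgue"
    "(\<lambda>K. \<integral>\<^sup>+t\<in>{0..1}. ennreal ((g t - (\<Sum>k<K. a k * walsh_rc (n k) t))\<^sup>2) \<partial>lebesgue) \<longlonglongrightarrow> 0"
proof -
  show "g \<in> borel_measurable lebesgue"
    using assms(1) unfolding g_def is_L2_sum_def by (intro borel_measurable_if_I) auto
  have "(\<integral>\<^sup>+t\<in>{0..1}. ennreal ((g t - (\<Sum>k<K. a k * walsh_rc (n k) t))\<^sup>2) \<partial>lebesgue)
      = (\<integral>\<^sup>+t\<in>{0..1}. ennreal ((f t - (\<Sum>k<K. a k * walsh (n k) t))\<^sup>2) \<partial>lebesgue)" for K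
    by (intro nn_integral_cong_AE eventually_mono[OF AE_walsh_eq_walsh_rc]) (simp add: g_def indicator_def)
  then show "(\<lambda>K. \<integral>\<^sup>+t\<in>{0..1}. ennreal ((g t - (\<Sum>k<K. a k * walsh_rc (n k) t))\<^sup>2) \<partial>lebesgue) \<longlonglongrightarrow> 0"
    using assms(1) by (simp add: is_L2_sum_def)
qed

theorem theorem3p1:
  fixes q :: real
  assumes "q > 1"
  shows "\<exists>A B. A > 0 \<and> B > 0 \<and>
    (\<forall>E. E \<subseteq> {0..1} \<and> E \<in> sets lebesgue \<and> measure lebesgue E > 0 \<longrightarrow>
      (\<exists>N::nat. \<forall>n a f. lacunary q n \<and> (\<forall>k. n k \<ge> N) \<and>
          summable (\<lambda>k. (a k)\<^sup>2) \<and> is_L2_sum a n f \<longrightarrow>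
          ereal (A * sqrt (\<Sum>k. (a k)\<^sup>2)) \<le> local_orlicz_norm f E \<and>
          local_orlicz_norm f E \<le> ereal (B * sqrt (\<Sum>k. (a k)\<^sup>2))))"
proof -
  \<comment> \<open>\<open>L\<close> lacunary steps at least double the index. \<open>L\<close>
    depends on \<open>q\<close> alone, and so do the constants \<open>1 / 2\<close> and
    \<open>4 * real L\<close>.\<close>
  obtain L where L: "2 < q ^ L"
    using real_arch_pow[OF assms] by blast
  then have "L > 0" by (cases L) auto
  have main: "\<exists>N::nat. \<forall>n a f. lacunary q n \<and> (\<forall>k. n k \<ge> N) \<and>
          summable (\<lambda>k. (a k)\<^sup>2) \<and> is_L2_sum a n f \<longrightarrow>
          ereal (1 / 2 * sqrt (\<Sum>k. (a k)\<^sup>2)) \<le> local_orlicz_norm f E \<and>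
          local_orlicz_norm f E \<le> ereal (4 * real L * sqrt (\<Sum>k. (a k)\<^sup>2))"
    if E: "E \<subseteq> {0..1}" "E \<in> sets lebesgue" "measure lebesgue E > 0" for E
  proof -
    define \<mu> where "\<mu> = measure lebesgue E"
    have "\<mu> > 0" using E by (simp add: \<mu>_def)
    \<comment> \<open>These are the bounds required by the lower estimate; the bound
      \<open>\<mu>\<^sup>2 / 64\<close> of the upper estimate follows because
      \<open>L > 0\<close>.\<close>
    define \<delta> where "\<delta> = min (\<mu>\<^sup>2 / (4096 * real L ^ 4)) (\<mu> / 64)"
    have "\<delta> > 0" using \<open>\<mu> > 0\<close> \<open>L > 0\<close> by (simp add: \<delta>_def)
    have "\<mu>\<^sup>2 / (4096 * real L ^ 4) \<le> \<mu>\<^sup>2 / 64"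
    proof (intro divide_left_mono)
      have "1 \<le> real L ^ 4" using \<open>L > 0\<close> by (intro one_le_power) simp
      then show "64 \<le> 4096 * real L ^ 4" by simp
    qed (use \<open>L > 0\<close> in auto)
    then have \<delta>: "0 \<le> \<delta>" "\<delta> \<le> \<mu>\<^sup>2 / 64" "\<delta> \<le> \<mu>\<^sup>2 / (4096 * real L ^ 4)" "\<delta> \<le> \<mu> / 64"
      using \<open>\<delta> > 0\<close> by (auto simp: \<delta>_def)
    obtain j F where F: "dyadic_measurable j (\<lambda>t. t \<in> F)" "F \<subseteq> {0..1}"
        "emeasure lebesgue (E - F) \<le> ennreal \<delta>" "emeasure lebesgue (F - E) \<le> ennreal \<delta>"
      using dyadic_approximation[OF E(2,1) \<open>\<delta> > 0\<close>] by blast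
    obtain m :: nat where m: "1 / (q - 1) < real m"
      using reals_Archimedean2 by blast
    \<comment> \<open>Besides \<open>2 ^ j \<le> N\<close>, this ensures that one lacunary step from
      any index at or beyond \<open>N\<close> jumps by at least \<open>2 ^ j\<close>, the gap needed
      for orthogonality on \<open>F\<close>.\<close>
    define N where "N = 2 ^ j * (m + 1)"
    have "2 ^ j \<le> (q - 1) * N"
    proof -
      have "1 \<le> (q - 1) * (m + 1)"
        using m assms by (simp add: field_simps)
      then have "2 ^ j * 1 \<le> 2 ^ j * ((q - 1) * (m + 1))"
        by (intro mult_left_mono) auto
      also have "\<dots> = (q - 1) * N"
        by (simp add: N_def algebra_simps)
      finally show ?thesis by simp
    qed
    show ?thesis
    proof (intro exI allI impI)
      fix n a f
      assume as: "lacunary q n \<and> (\<forall>k. n k \<ge> N) \<and> summable (\<lambda>k. (a k)\<^sup>2) \<and> is_L2_sum a n f"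
      define g where "g t = (if t \<in> {0..1} then f t else 0)" for t
      have g: "g \<in> borel_measurable lebesgue"
        "(\<lambda>K. \<integral>\<^sup>+t\<in>{0..1}. ennreal ((g t - (\<Sum>k<K. a k * walsh_rc (n k) t))\<^sup>2) \<partial>lebesgue) \<longlonglongrightarrow> 0"
        using is_L2_sum_walsh_rc[of a n f] as unfolding g_def by blast+
      have sum: "summable (\<lambda>k. (a k)\<^sup>2)" using as by blast
      have n2: "2 * n k \<le> n (k + L)" for k
      proof -
        have "2 * real (n k) \<le> q ^ L * real (n k)"
          using L by (intro mult_right_mono) auto
        also have "\<dots> \<le> real (n (k + L))"
          using as assms by (intro lacunary_power_le) auto
        finally show ?thesis by linarith
      qed
      have nj: "2 ^ j \<le> n k" for k
      proof -
        have "2 ^ j \<le> N" by (simp add: N_def)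
        also have "N \<le> n k" using as by blast
        finally show ?thesis .
      qed
      have gap: "n k + 2 ^ j \<le> n (Suc k)" for k
      proof -
        have "(q - 1) * real N \<le> (q - 1) * real (n k)"
          using as assms by (intro mult_left_mono) auto
        then have "real (n k) + 2 ^ j \<le> q * real (n k)"
          using \<open>2 ^ j \<le> (q - 1) * N\<close> by (simp add: algebra_simps)
        also have "\<dots> \<le> real (n (Suc k))"
          using lacunary_power_le[of q n 1 k] as assms by simp
        finally have "real (n k + 2 ^ j) \<le> real (n (Suc k))" by simp
        then show ?thesis by (simp only: of_nat_le_iff)
      qed
      have int_g: "(\<integral>\<^sup>+t\<in>E. ennreal (M2 (\<bar>f t\<bar> / c)) \<partial>lebesgue) = (\<integral>\<^sup>+t\<in>E. ennreal (M2 (\<bar>g t\<bar> / c)) \<partial>lebesgue)" for c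
        using E(1) by (intro nn_integral_cong) (auto simp: g_def indicator_def)
      let ?C = "{c::real. c > 0 \<and> (\<integral>\<^sup>+t\<in>E. ennreal (M2 (\<bar>f t\<bar> / c)) \<partial>lebesgue) \<le> ennreal (measure lebesgue E)}"
      have "ereal (1 / 2 * sqrt (\<Sum>k. (a k)\<^sup>2)) \<le> local_orlicz_norm f E"
        unfolding local_orlicz_norm_def
      proof (rule Inf_greatest)
        fix x assume "x \<in> ereal ` ?C"
        then obtain c where c: "x = ereal c" "c > 0"
            "(\<integral>\<^sup>+t\<in>E. ennreal (M2 (\<bar>g t\<bar> / c)) \<partial>lebesgue) \<le> ennreal \<mu>"
          by (auto simp: int_g \<mu>_def)
        have "1 / 2 * sqrt (\<Sum>k. (a k)\<^sup>2) \<le> c"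
          by (rule sqrt_sum_squares_le[where n = n and L = L and j = j and a = a, OF n2 nj \<open>L > 0\<close> gap sum g F(1,2) E(2,1) \<mu>_def \<open>\<mu> > 0\<close> F(3,4) \<delta>(1,3,4) c(2,3)])
        then show "ereal (1 / 2 * sqrt (\<Sum>k. (a k)\<^sup>2)) \<le> x"
          by (simp add: c(1))
      qed
      moreover have "local_orlicz_norm f E \<le> ereal (4 * real L * sqrt (\<Sum>k. (a k)\<^sup>2))"
      proof (rule ereal_le_epsilon2)
        fix e :: real assume "e > 0"
        \<comment> \<open>Admissible values of \<open>c\<close> must be positive, while all
          coefficients may vanish; the slack \<open>e\<close> covers that case.\<close>
        define c where "c = 4 * real L * sqrt (\<Sum>k. (a k)\<^sup>2) + e"
        have "0 \<le> 4 * real L * sqrt (\<Sum>k. (a k)\<^sup>2)"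
          using sum by (simp add: suminf_nonneg)
        then have c: "c > 0" "4 * real L * sqrt (\<Sum>k. (a k)\<^sup>2) \<le> c"
          using \<open>e > 0\<close> by (auto simp: c_def)
        have "(\<integral>\<^sup>+t\<in>E. ennreal (M2 (\<bar>g t\<bar> / c)) \<partial>lebesgue) \<le> ennreal \<mu>"
          by (rule nn_integral_M2_le_measure[where n = n and L = L and j = j and a = a, OF n2 nj \<open>L > 0\<close> sum g F(1,2) E(2,1) \<mu>_def \<open>\<mu> > 0\<close> F(3,4) \<delta>(1,2,4) c])
        then have "c \<in> ?C"
          using c by (simp add: int_g \<mu>_def)
        then have "local_orlicz_norm f E \<le> ereal c"
          unfolding local_orlicz_norm_def by (intro Inf_lower imageI)
        then show "local_orlicz_norm f E \<le> ereal (4 * real L * sqrt (\<Sum>k. (a k)\<^sup>2)) + ereal e"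
          by (simp add: c_def)
      qed
      ultimately show "ereal (1 / 2 * sqrt (\<Sum>k. (a k)\<^sup>2)) \<le> local_orlicz_norm f E \<and>
          local_orlicz_norm f E \<le> ereal (4 * real L * sqrt (\<Sum>k. (a k)\<^sup>2))"
        by blast
    qed
  qed
  show ?thesis
    using main \<open>L > 0\<close> by (intro exI[of _ "1 / 2"] exI[of _ "4 * real L"]) auto
qed

end
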